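(* Let $\{P_n\}_{n\ge0}$ be an $N\times N$ sequence of matrix-valued orthogonal polynomials (with respect to some weight matrix $W$), and for $j=1,\dots,M$ let $\{p_{j,n}\}_{n\ge0}$ be a $d_j\times d_j$ sequence of matrix-valued orthogonal polynomials (with respect to some weight matrix $w_j$), where $d_1+\cdots+d_M=N$. Then $\{P_n\}$ is a Darboux transformation of $\{p_{1,n}\oplus\cdots\oplus p_{M,n}\}$ if and only if, for each $j=1,\dots,M$, there exists a $d_j\times N$ matrix-valued linear differential operator $D_j$ satisfying $$\Lambda_n(D_j)\,P_n=p_{j,n}\cdot D_j\quad\text{for all } n\in\mathbb{N}_0,$$ for some $d_j\times N$ matrices $\Lambda_n(D_j)$ with complex entries, and the $N\times N$ matrix $$\begin{pmatrix}\Lambda_n(D_1)\\ \Lambda_n(D_2)\\ \vdots\\ \Lambda_n(D_M)\end{pmatrix}$$ obtained by stacking the blocks $\Lambda_n(D_j)$ vertically is invertible for some $n$.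
   Context: Fix a possibly infinite interval $(x_0,x_1)$ of the real line. A weight matrix of size $N$ is a complex $N\times N$ matrix-valued smooth function $W$ on $(x_0,x_1)$ that is positive definite almost everywhere and has finite moments of all orders. For $P,Q\in\operatorname{Mat}_N(\mathbb{C}[x])$ put $\langle P,Q\rangle_W=\int_{x_0}^{x_1}P(x)W(x)Q(x)^*\,dx$, where $*$ is the Hermitian conjugate. A sequence of matrix-valued orthogonal polynomials with respect to $W$ is a sequence $\{P_n\}_{n\in\mathbb{N}_0}$ in $\operatorname{Mat}_N(\mathbb{C}[x])$, $\mathbb{N}_0=\{0,1,\dots\}$, with $P_n$ of degree $n$ with nonsingular leading coefficient and $\langle P_n,P_m\rangle_W=0$ for $n\ne m$. The direct sum $F_1\oplus\cdots\oplus F_r$ is the block diagonal matrix with blocks $F_1,\dots,F_r$. Differential operators $D=\sum_{i=0}^s\partial^iF_i(x)$, $\partial=\frac{d}{dx}$, act on the right: $(P\cdot D)(x)=\sum_{i=0}^s\frac{d^iP}{dx^i}(x)F_i(x)$, and $P\cdot(DE)=(P\cdot D)\cdot E$. All differential operators (square or rectangular) have coefficients $F_i$ with entries in $\mathbb{C}[x]$. $\operatorname{Mat}_N(\Omega[x])$ is the algebra of $N\times N$ such operators. $\mathcal{D}(W)$ is the set of $D\in\operatorname{Mat}_N(\Omega[x])$ such that, for every $n\in\mathbb{N}_0$, $P_n\cdot D=\Lambda_n(D)P_n$ for some $\Lambda_n(D)\in\operatorname{Mat}_N(\mathbb{C})$ (this does not depend on the chosen orthogonal sequence $\{P_n\}$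 for $W$). An operator $E\in\operatorname{Mat}_N(\Omega[x])$ is degree-preserving if, for all but finitely many $n\in\mathbb{N}_0$, for any (matrix) polynomial $f$ of degree $n$ the function $f\cdot E$ is again a polynomial of degree $n$. For sequences $\{P_n\},\{\tilde P_n\}$ of $N\times N$ matrix-valued orthogonal polynomials with respect to $W,\tilde W$, $\{\tilde P_n\}$ is a Darboux transformation of $\{P_n\}$ if there is $D\in\mathcal{D}(W)$ that can be factorized as $D=\mathcal{V}\mathcal{N}$ with degree-preserving $\mathcal{V},\mathcal{N}\in\operatorname{Mat}_N(\Omega[x])$ such that $P_n\cdot\mathcal{V}=A_n\tilde P_n$ for all $n\in\mathbb{N}_0$, for some $A_n\in\operatorname{Mat}_N(\mathbb{C})$. For $D=\sum_j\partial^jF_j$ let $D^*=\sum_jF_j(x)^*(-1)^j\partial^j$ be the formal adjoint; thus $Q\cdot(WD^*W^{-1})=\sum_j(-1)^j\frac{d^j}{dx^j}(QWF_j^* )W^{-1}$. Standing assumption on weights: all weight matrices considered (including direct sums of the weights considered) are "good enough" in the following sense, written for a weight $W$ of size $N$: if $D\in\operatorname{Mat}_N(\Omega[x])$ and $A\in\operatorname{Mat}_N(\mathbb{C}[x])$ satisfy $\int_{x_0}^{x_1}PAW\,dx=\int_{x_0}^{x_1}P\,(W\cdot D)\,dx$ for all $P\in\operatorname{Mat}_N(\mathbb{C}[x])$, then $AW=W\cdot D$. In particular, whenever $D,\tilde D\in\operatorname{Mat}_N(\Omega[x])$ satisfy $\langle P\cdot D,Q\rangle_W=\langle P,Q\cdot\tilde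 D\rangle_W$ for all $P,Q\in\operatorname{Mat}_N(\mathbb{C}[x])$, one has $\tilde D=WD^*W^{-1}$. *)

theory Defs
  imports
    "HOL-Analysis.Interval_Integral"
    "Jordan_Normal_Form.Schur_Decomposition"
begin

definition eval_mat :: "complex poly mat \<Rightarrow> real \<Rightarrow> complex mat" where
  "eval_mat P x = map_mat (\<lambda>p. poly p (of_real x)) P"

definition const_mat :: "complex mat \<Rightarrow> complex poly mat" where
  "const_mat A = map_mat (\<lambda>c. [:c:]) A"

definition coeff_mat :: "complex poly mat \<Rightarrow> nat \<Rightarrow> complex mat" where
  "coeff_mat P n = map_mat (\<lambda>p. coeff p n) P"

definition degree_le :: "complex poly mat \<Rightarrow> nat \<Rightarrow> bool" where
  "degree_le P n \<longleftrightarrow> (\<forall>i<dim_row P. \<forall>j<dim_col P. degree (P $$ (i, j)) \<le> n)"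

text \<open>The zero matrix has no degree in this sense.\<close>
definition has_degree :: "complex poly mat \<Rightarrow> nat \<Rightarrow> bool" where
  "has_degree P n \<longleftrightarrow> degree_le P n \<and> coeff_mat P n \<noteq> 0\<^sub>m (dim_row P) (dim_col P)"

definition nth_deriv :: "nat \<Rightarrow> (real \<Rightarrow> complex) \<Rightarrow> real \<Rightarrow> complex" where
  "nth_deriv k f = ((\<lambda>g x. vector_derivative g (at x)) ^^ k) f"

text \<open>Adequate for open \<open>S\<close>, where the two-sided derivatives only depend on \<open>f\<close> on \<open>S\<close>.\<close>
definition smooth_on :: "real set \<Rightarrow> (real \<Rightarrow> complex) \<Rightarrow> bool" where
  "smooth_on S f \<longleftrightarrow> (\<forall>k. \<forall>x\<in>S. nth_deriv k f differentiable (at x))"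

definition positive_definite :: "nat \<Rightarrow> complex mat \<Rightarrow> bool" where
  "positive_definite N A \<longleftrightarrow>
     A \<in> carrier_mat N N \<and> mat_adjoint A = A \<and>
     (\<forall>v\<in>carrier_vec N. v \<noteq> 0\<^sub>v N \<longrightarrow> 0 < Re ((A *\<^sub>v v) \<bullet>c v))"

definition weight :: "ereal \<Rightarrow> ereal \<Rightarrow> nat \<Rightarrow> (real \<Rightarrow> complex mat) \<Rightarrow> bool" where
  "weight x0 x1 N W \<longleftrightarrow>
     0 < N \<and>
     (\<forall>x\<in>einterval x0 x1. W x \<in> carrier_mat N N) \<and>
     (\<forall>i<N. \<forall>j<N. smooth_on (einterval x0 x1) (\<lambda>x. W x $$ (i, j))) \<and>
     (AE x in lborel. x \<in> einterval x0 x1 \<longrightarrow> positive_definite N (W x)) \<and>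
     (\<forall>n. \<forall>i<N. \<forall>j<N. set_integrable lborel (einterval x0 x1)
        (\<lambda>x. of_real (x ^ n) * W x $$ (i, j)))"

definition mat_integrable :: "ereal \<Rightarrow> ereal \<Rightarrow> nat \<Rightarrow> (real \<Rightarrow> complex mat) \<Rightarrow> bool" where
  "mat_integrable x0 x1 N F \<longleftrightarrow>
     (\<forall>i<N. \<forall>j<N. set_integrable lborel (einterval x0 x1) (\<lambda>x. F x $$ (i, j)))"

definition mat_integral :: "ereal \<Rightarrow> ereal \<Rightarrow> nat \<Rightarrow> (real \<Rightarrow> complex mat) \<Rightarrow> complex mat" where
  "mat_integral x0 x1 N F =
     Matrix.mat N N (\<lambda>(i, j). set_lebesgue_integral lborel (einterval x0 x1) (\<lambda>x. F x $$ (i, j)))"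

definition weight_inner ::
  "ereal \<Rightarrow> ereal \<Rightarrow> nat \<Rightarrow> (real \<Rightarrow> complex mat) \<Rightarrow> complex poly mat \<Rightarrow> complex poly mat \<Rightarrow> complex mat" where
  "weight_inner x0 x1 N W P Q =
     mat_integral x0 x1 N (\<lambda>x. eval_mat P x * W x * mat_adjoint (eval_mat Q x))"

definition mvop ::
  "ereal \<Rightarrow> ereal \<Rightarrow> nat \<Rightarrow> (real \<Rightarrow> complex mat) \<Rightarrow> (nat \<Rightarrow> complex poly mat) \<Rightarrow> bool" where
  "mvop x0 x1 N W P \<longleftrightarrow>
     (\<forall>n. P n \<in> carrier_mat N N \<and> degree_le (P n) n \<and> invertible_mat (coeff_mat (P n) n)) \<and>
     (\<forall>n m. n \<noteq> m \<longrightarrow> weight_inner x0 x1 N W (P n) (P m) = 0\<^sub>m N N)"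

definition weight_direct_sum :: "(real \<Rightarrow> complex mat) list \<Rightarrow> real \<Rightarrow> complex mat" where
  "weight_direct_sum Ws = (\<lambda>x. diag_block_mat (map (\<lambda>W. W x) Ws))"

text \<open>
  A scalar operator \<open>\<Sum>\<^sub>i \<partial>\<^sup>i f\<^sub>i(x)\<close> is stored as the polynomial in \<open>\<partial>\<close> whose \<open>i\<close>-th
  coefficient is the polynomial \<open>f\<^sub>i\<close>; a matrix operator \<open>\<Sum>\<^sub>i \<partial>\<^sup>i F\<^sub>i(x)\<close> is the matrix of
  its scalar entries. The library multiplication on \<^typ>\<open>complex poly poly\<close> is commutative
  and is not composition of operators; composition is \<open>dop_mult\<close> and \<open>dop_mat_mult\<close>.
\<close>
type_synonym dop = "complex poly poly"

definition dop_act :: "complex poly \<Rightarrow> dop \<Rightarrow> complex poly" where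
  "dop_act p e = (\<Sum>i\<le>degree e. (pderiv ^^ i) p * coeff e i)"

text \<open>\<open>\<partial>\<^sup>i f \<partial>\<^sup>j g = \<Sum>\<^sub>k (j choose k) \<partial>\<^sup>i\<^sup>+\<^sup>k f\<^sup>(\<^sup>j\<^sup>-\<^sup>k\<^sup>) g\<close>, by the Leibniz rule.\<close>
definition dop_mult :: "dop \<Rightarrow> dop \<Rightarrow> dop" where
  "dop_mult e f =
     (\<Sum>i\<le>degree e. \<Sum>j\<le>degree f. \<Sum>k\<le>j.
        monom (of_nat (j choose k) * (pderiv ^^ (j - k)) (coeff e i) * coeff f j) (i + k))"

definition dop_mat_act :: "complex poly mat \<Rightarrow> dop mat \<Rightarrow> complex poly mat" where
  "dop_mat_act P D = Matrix.mat (dim_row P) (dim_col D)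
     (\<lambda>(r, c). \<Sum>k<dim_col P. dop_act (P $$ (r, k)) (D $$ (k, c)))"

definition dop_mat_mult :: "dop mat \<Rightarrow> dop mat \<Rightarrow> dop mat" where
  "dop_mat_mult D E = Matrix.mat (dim_row D) (dim_col E)
     (\<lambda>(r, c). \<Sum>k<dim_col D. dop_mult (D $$ (r, k)) (E $$ (k, c)))"

definition dop_mat_act_fun :: "(real \<Rightarrow> complex mat) \<Rightarrow> dop mat \<Rightarrow> real \<Rightarrow> complex mat" where
  "dop_mat_act_fun W D x = Matrix.mat (dim_row (W x)) (dim_col D)
     (\<lambda>(r, c). \<Sum>k<dim_col (W x). \<Sum>i\<le>degree (D $$ (k, c)).
        nth_deriv i (\<lambda>y. W y $$ (r, k)) x * poly (coeff (D $$ (k, c)) i) (of_real x))"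

lemma pderiv_power_add: "(pderiv ^^ n) (p + q) = (pderiv ^^ n) p + (pderiv ^^ n) q"
  by (induction n) (simp_all add: pderiv_add)

lemma pderiv_power_sum: "(pderiv ^^ n) (sum f A) = (\<Sum>x\<in>A. (pderiv ^^ n) (f x))"
proof -
  have "(pderiv ^^ n) 0 = (0 :: 'a poly)" for n
    by (induction n) simp_all
  then show ?thesis
    by (induction A rule: infinite_finite_induct) (simp_all add: pderiv_power_add)
qed

lemma pderiv_power_mult:
  fixes p q :: "complex poly"
  shows "(pderiv ^^ n) (p * q) =
    (\<Sum>k\<le>n. of_nat (n choose k) * (pderiv ^^ k) p * (pderiv ^^ (n - k)) q)"
proof (induction n)
  case 0
  then show ?case by simp
next
  case (Suc n)
  let ?t = "\<lambda>k m. (pderiv ^^ k) p * (pderiv ^^ m) q"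
  have pd: "pderiv (of_nat c * ?t k m) = of_nat c * ?t (Suc k) m + of_nat c * ?t k (Suc m)"
    for c k m
    by (simp add: pderiv_mult pderiv_of_nat algebra_simps)
  have "(pderiv ^^ Suc n) (p * q) = pderiv (\<Sum>k\<le>n. of_nat (n choose k) * ?t k (n - k))"
    using Suc by (simp add: mult.assoc)
  also have "\<dots> = (\<Sum>k\<le>n. pderiv (of_nat (n choose k) * ?t k (n - k)))"
    using pderiv_power_sum[of 1] by simp
  also have "\<dots> = (\<Sum>k\<le>n. of_nat (n choose k) * ?t (Suc k) (n - k)) +
      (\<Sum>k\<le>n. of_nat (n choose k) * ?t k (Suc (n - k)))"
    by (simp only: pd sum.distrib)
  also have "(\<Sum>k\<le>n. of_nat (n choose k) * ?t k (Suc (n - k))) =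
      (\<Sum>k\<le>Suc n. of_nat (n choose k) * ?t k (Suc n - k))"
    by (simp add: Suc_diff_le cong: sum.cong_simp)
  also have "\<dots> = ?t 0 (Suc n) + (\<Sum>k\<le>n. of_nat (n choose Suc k) * ?t (Suc k) (n - k))"
    by (subst sum.atMost_Suc_shift) (simp del: funpow.simps)
  also have "(\<Sum>k\<le>n. of_nat (n choose k) * ?t (Suc k) (n - k)) +
      (?t 0 (Suc n) + (\<Sum>k\<le>n. of_nat (n choose Suc k) * ?t (Suc k) (n - k))) =
      ?t 0 (Suc n) + (\<Sum>k\<le>n. of_nat (Suc n choose Suc k) * ?t (Suc k) (n - k))"
    by (simp add: sum.distrib algebra_simps del: funpow.simps)
  also have "\<dots> = (\<Sum>k\<le>Suc n. of_nat (Suc n choose k) * ?t k (Suc n - k))"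
    by (subst sum.atMost_Suc_shift) (simp del: funpow.simps binomial_Suc_Suc)
  finally show ?case by (simp add: mult.assoc)
qed

lemma dop_act_eq:
  assumes "degree e \<le> n"
  shows "dop_act p e = (\<Sum>i\<le>n. (pderiv ^^ i) p * coeff e i)"
  unfolding dop_act_def
  using assms by (intro sum.mono_neutral_left) (auto simp: coeff_eq_0)

lemma dop_act_add_left: "dop_act (p + q) e = dop_act p e + dop_act q e"
  by (simp add: dop_act_def pderiv_power_add sum.distrib algebra_simps)

lemma dop_act_sum_left: "dop_act (sum f A) e = (\<Sum>x\<in>A. dop_act (f x) e)"
  unfolding dop_act_def
  by (subst sum.swap) (simp add: pderiv_power_sum sum_distrib_right)

lemma dop_act_add_right: "dop_act p (e + f) = dop_act p e + dop_act p f"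
proof -
  define n where "n = max (degree e) (degree f)"
  have "degree (e + f) \<le> n" "degree e \<le> n" "degree f \<le> n"
    by (auto simp: n_def degree_add_le_max)
  then show ?thesis
    by (simp add: dop_act_eq[of _ n] sum.distrib algebra_simps)
qed

lemma dop_act_sum_right: "dop_act p (sum f A) = (\<Sum>x\<in>A. dop_act p (f x))"
  by (induction A rule: infinite_finite_induct)
     (simp_all add: dop_act_add_right, simp_all add: dop_act_def)

lemma dop_act_monom: "dop_act p (monom a i) = (pderiv ^^ i) p * a"
  by (simp add: dop_act_eq[OF degree_monom_le] if_distrib[of "\<lambda>x. _ * x"] sum.delta
      cong: if_cong)

lemma dop_act_mult: "dop_act p (dop_mult e f) = dop_act (dop_act p e) f"
proof -
  have "dop_act (dop_act p e) f =
    (\<Sum>j\<le>degree f. (\<Sum>i\<le>degree e. (pderiv ^^ j) ((pderiv ^^ i) p * coeff e i)) * coeff f j)"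
    by (simp add: dop_act_def pderiv_power_sum)
  also have "\<dots> = (\<Sum>i\<le>degree e. \<Sum>j\<le>degree f. \<Sum>k\<le>j. (pderiv ^^ (i + k)) p *
      (of_nat (j choose k) * (pderiv ^^ (j - k)) (coeff e i) * coeff f j))"
  proof -
    have "(pderiv ^^ j) ((pderiv ^^ i) p * coeff e i) * coeff f j =
        (\<Sum>k\<le>j. (pderiv ^^ (i + k)) p *
          (of_nat (j choose k) * (pderiv ^^ (j - k)) (coeff e i) * coeff f j))" for i j
      by (simp only: pderiv_power_mult sum_distrib_right add.commute[of i] funpow_add o_apply)
        (simp add: mult_ac)
    then show ?thesis
      by (subst sum.swap) (simp add: sum_distrib_right)
  qed
  finally show ?thesis
    by (simp add: dop_mult_def dop_act_sum_right dop_act_monom)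
qed

text \<open>The composition realises \<open>P \<cdot> (D E) = (P \<cdot> D) \<cdot> E\<close>.\<close>
lemma dop_mat_act_mult:
  assumes "P \<in> carrier_mat a b" "D \<in> carrier_mat b c" "E \<in> carrier_mat c d"
  shows "dop_mat_act P (dop_mat_mult D E) = dop_mat_act (dop_mat_act P D) E"
  using assms
  by (intro eq_matI)
     (auto simp: dop_mat_act_def dop_mat_mult_def dop_act_sum_right dop_act_sum_left
       dop_act_mult intro: sum.swap)

definition weight_algebra :: "ereal \<Rightarrow> ereal \<Rightarrow> nat \<Rightarrow> (real \<Rightarrow> complex mat) \<Rightarrow> dop mat set" where
  "weight_algebra x0 x1 N W = {D \<in> carrier_mat N N.
     \<exists>P. mvop x0 x1 N W P \<and>
       (\<forall>n. \<exists>L\<in>carrier_mat N N. dop_mat_act (P n) D = const_mat L * P n)}"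

definition degree_preserving :: "nat \<Rightarrow> dop mat \<Rightarrow> bool" where
  "degree_preserving N E \<longleftrightarrow> E \<in> carrier_mat N N \<and>
     (\<forall>\<^sub>F n in sequentially. \<forall>f\<in>carrier_mat N N.
        has_degree f n \<longrightarrow> has_degree (dop_mat_act f E) n)"

text \<open>\<open>Pt\<close> is a Darboux transformation of the orthogonal sequence \<open>P\<close> of \<open>W\<close>.\<close>
definition darboux_transformation ::
  "ereal \<Rightarrow> ereal \<Rightarrow> nat \<Rightarrow> (real \<Rightarrow> complex mat) \<Rightarrow> (nat \<Rightarrow> complex poly mat)
     \<Rightarrow> (nat \<Rightarrow> complex poly mat) \<Rightarrow> bool" where
  "darboux_transformation x0 x1 N W P Pt \<longleftrightarrow>
     (\<exists>D\<in>weight_algebra x0 x1 N W. \<exists>V E.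
        D = dop_mat_mult V E \<and> degree_preserving N V \<and> degree_preserving N E \<and>
        (\<forall>n. \<exists>A\<in>carrier_mat N N. dop_mat_act (P n) V = const_mat A * Pt n))"

text \<open>The integrals of \<open>P (W \<cdot> D)\<close> need not converge, so their existence is part of the premise.\<close>
definition good_enough :: "ereal \<Rightarrow> ereal \<Rightarrow> nat \<Rightarrow> (real \<Rightarrow> complex mat) \<Rightarrow> bool" where
  "good_enough x0 x1 N W \<longleftrightarrow>
     (\<forall>D\<in>carrier_mat N N. \<forall>A\<in>carrier_mat N N.
        (\<forall>P\<in>carrier_mat N N.
           mat_integrable x0 x1 N (\<lambda>x. eval_mat P x * dop_mat_act_fun W D x) \<and>
           mat_integral x0 x1 N (\<lambda>x. eval_mat P x * eval_mat A x * W x) =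
           mat_integral x0 x1 N (\<lambda>x. eval_mat P x * dop_mat_act_fun W D x)) \<longrightarrow>
        (\<forall>x\<in>einterval x0 x1. eval_mat A x * W x = dop_mat_act_fun W D x))"

definition stack_rows :: "nat \<Rightarrow> complex mat list \<Rightarrow> complex mat" where
  "stack_rows nc As = mat_of_rows nc (concat (map rows As))"

end

theory Submission
  imports Defs
begin

text \<open>
  Write \<open>Z\<close> and \<open>Q\<^sub>n\<close> for the direct sums of the weights \<open>w\<^sub>j\<close> and of the sequences \<open>p\<^sub>j\<^sub>,\<^sub>n\<close>.
  Stacking the \<open>D\<^sub>j\<close> yields an operator \<open>V\<close> with \<open>Q\<^sub>n \<cdot> V = A\<^sub>n P\<^sub>n\<close>, where \<open>A\<^sub>n\<close> is the stack of the
  \<open>\<Lambda>\<^sub>n(D\<^sub>j)\<close>, and conversely the row blocks of such a \<open>V\<close> are operators \<open>D\<^sub>j\<close>. Such a \<open>V\<close> does not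
  raise degrees, and the coefficient of \<open>x\<^sup>n\<close> in \<open>x\<^sup>n \<cdot> V\<close> is a matrix \<open>S(n)\<close> that is polynomial
  in \<open>n\<close>; as \<open>lc(Q\<^sub>n) S(n) = A\<^sub>n lc(P\<^sub>n)\<close>, one invertible \<open>A\<^sub>n\<close> makes \<open>det S(n)\<close> nonzero for almost
  all \<open>n\<close>, so \<open>V\<close> is degree-preserving.

  The second factor is the adjoint \<open>E\<close> of \<open>V\<close>, that is \<open>\<langle>u \<cdot> V, v\<rangle>\<^sub>W = \<langle>u, v \<cdot> E\<rangle>\<^sub>Z\<close>. As a linear map it
  is given by \<open>P\<^sub>n \<mapsto> B\<^sub>n Q\<^sub>n\<close> with \<open>B\<^sub>n\<close> determined by \<open>A\<^sub>n\<close> and the Gram matrices of \<open>P\<^sub>n\<close> and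
  \<open>Q\<^sub>n\<close>. It is a differential operator because multiplication by the real variable \<open>x\<close> is
  symmetric for both forms: the iterated commutators of \<open>E\<close> with \<open>x\<close> are, up to sign, adjoint to
  those of \<open>V\<close>, hence vanish eventually.
\<close>

subsection \<open>Commutators of differential operators with multiplication by x\<close>

text \<open>\<open>pCons 0 f\<close> is x f, so this is the commutator of \<open>T\<close> with
  multiplication by x.\<close>

definition shift_comm :: "(complex poly \<Rightarrow> complex poly) \<Rightarrow> complex poly \<Rightarrow> complex poly" where
  "shift_comm T f = T (pCons 0 f) - pCons 0 (T f)"

text \<open>Leibniz rule for x f, where derivatives of x beyond the first vanish. For i = 0 the
  truncated index \<open>i - 1\<close> is harmless because its factor is 0.\<close>

lemma pderiv_power_pCons_0:
  "(pderiv ^^ i) (pCons 0 f) = pCons 0 ((pderiv ^^ i) f) + of_nat i * (pderiv ^^ (i - 1)) f"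
proof (induction i)
  case (Suc i)
  have "pderiv (of_nat i * (pderiv ^^ (i - 1)) f) = of_nat i * (pderiv ^^ i) f"
    by (cases i) (simp_all add: pderiv_mult pderiv_of_nat del: of_nat_Suc)
  with Suc show ?case
    by (simp add: pderiv_add pderiv_pCons algebra_simps)
qed simp

lemma pCons_0_sum: "pCons 0 (\<Sum>i\<in>A. g i) = (\<Sum>i\<in>A. pCons 0 (g i))"
  by (induction A rule: infinite_finite_induct) (simp_all, metis add_pCons add.right_neutral)

text \<open>The commutator of \<partial>^i with x is i \<partial>^(i-1). Hence commutation with x
  turns the operator \<open>e\<close> into \<open>pderiv e\<close>, where \<open>pderiv\<close> on a
  \<open>dop\<close> differentiates in the variable \<partial> and not in x.\<close>

lemma dop_act_pCons_0: "dop_act (pCons 0 f) e = pCons 0 (dop_act f e) + dop_act f (pderiv e)"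
proof -
  have m: "dop_act (pCons 0 f) (monom a i) =
      pCons 0 (dop_act f (monom a i)) + dop_act f (pderiv (monom a i))" for a i
    by (simp add: dop_act_monom pderiv_monom pderiv_power_pCons_0 algebra_simps)
  have e: "e = (\<Sum>i\<le>degree e. monom (coeff e i) i)"
    by (simp add: poly_as_sum_of_monoms)
  have p: "pderiv e = (\<Sum>i\<le>degree e. pderiv (monom (coeff e i) i))"
    by (subst e) (use pderiv_power_sum[of 1] in simp)
  show ?thesis
    by (subst (1 2) e, subst p)
      (simp only: dop_act_sum_right m sum.distrib pCons_0_sum)
qed

lemma pderiv_power_smult: "(pderiv ^^ i) (smult a f) = smult a ((pderiv ^^ i) f)"
  by (induction i) (simp_all add: pderiv_smult)

lemma dop_act_smult_left: "dop_act (smult a f) e = smult a (dop_act f e)"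
  by (simp add: dop_act_def pderiv_power_smult smult_sum2)

lemma dop_act_0_left [simp]: "dop_act 0 e = 0"
  using dop_act_smult_left[of 0 0 e] by simp

lemma dop_act_0_right [simp]: "dop_act f 0 = 0"
  by (simp add: dop_act_def)

text \<open>Termwise integration in \<partial>, with the coefficient polynomials in x treated as
  constants.\<close>

lemma pderiv_surj: "\<exists>e::dop. pderiv e = e'"
proof
  let ?m = "\<lambda>i. monom (smult (inverse (of_nat (Suc i))) (coeff e' i)) (Suc i)"
  have "pderiv (?m i) = monom (coeff e' i) i" for i
    by (simp add: pderiv_monom of_nat_poly del: of_nat_Suc)
  then show "pderiv (\<Sum>i\<le>degree e'. ?m i) = e'"
    using pderiv_power_sum[of 1 ?m] by (simp add: poly_as_sum_of_monoms)
qed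

text \<open>The commutator with multiplication by \<open>x\<close> acts on operators as \<open>\<partial>\<close>-differentiation, so an
  operator with commutator \<open>T\<close> is found by integrating in \<open>\<partial>\<close>.\<close>
lemma dop_exists_if_shift_comm_nilpotent:
  assumes "\<And>f g. T (f + g) = T f + T g" and "\<And>a f. T (smult a f) = smult a (T f)"
    and "\<And>f. (shift_comm ^^ n) T f = 0"
  shows "\<exists>e. \<forall>f. T f = dop_act f e"
  using assms
proof (induction n arbitrary: T)
  case 0
  then show ?case by (intro exI[of _ 0]) simp
next
  case (Suc n)
  note add = Suc.prems(1) and smult = Suc.prems(2)
  have "\<exists>e. \<forall>f. shift_comm T f = dop_act f e"
  proof (rule Suc.IH)
    show "shift_comm T (f + g) = shift_comm T f + shift_comm T g" for f g
      using add[of "pCons 0 f" "pCons 0 g"] add[of f g] by (simp add: shift_comm_def)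
    show "shift_comm T (smult a f) = smult a (shift_comm T f)" for a f
      using smult[of a "pCons 0 f"] smult[of a f] by (simp add: shift_comm_def smult_diff_right)
    show "(shift_comm ^^ n) (shift_comm T) f = 0" for f
      using Suc.prems(3)[of f] by (simp add: funpow_Suc_right del: funpow.simps)
  qed
  then obtain e' where e': "\<And>f. shift_comm T f = dop_act f e'" by blast
  obtain e where e: "pderiv e = e'" using pderiv_surj by blast
  define S where "S f = T f - dop_act f e" for f
  have S_shift: "S (pCons 0 f) = pCons 0 (S f)" for f
    using e'[of f] by (simp add: S_def dop_act_pCons_0 e shift_comm_def algebra_simps)
  have S_add: "S (f + g) = S f + S g" for f g
    by (simp add: S_def add dop_act_add_left)
  have S_smult: "S (smult a f) = smult a (S f)" for a f
    by (simp add: S_def smult dop_act_smult_left smult_diff_right)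
  \<comment> \<open>\<open>S\<close> is linear and commutes with x, so its value at 1 determines it:
    it is an operator of order 0, which is added to \<open>e\<close> below.\<close>
  have "S f = f * S 1" for f
  proof (induction f)
    case 0
    show ?case using S_smult[of 0 0] by simp
  next
    case (pCons a f)
    have "pCons a f = smult a 1 + pCons 0 f" by simp
    then have "S (pCons a f) = S (smult a 1 + pCons 0 f)" by (rule arg_cong)
    also have "\<dots> = smult a (S 1) + pCons 0 (S f)"
      by (simp only: S_add S_smult S_shift)
    finally show ?case using pCons by simp
  qed
  then have "T f = dop_act f (e + monom (S 1) 0)" for f
    by (simp add: S_def dop_act_add_right dop_act_monom algebra_simps)
  then show ?case by blast
qed

subsection \<open>The sesquilinear form of a weight on polynomial rows\<close>

lemma dim_mat_adjoint [simp]: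
  "dim_row (mat_adjoint A) = dim_col A" "dim_col (mat_adjoint A) = dim_row A"
  by (simp_all add: mat_adjoint_def)

lemma index_mat_adjoint [simp]:
  "i < dim_col A \<Longrightarrow> j < dim_row A \<Longrightarrow> mat_adjoint A $$ (i, j) = conjugate (A $$ (j, i))"
  by (simp add: mat_adjoint_def mat_of_rows_def)

lemma set_integrable_sum:
  fixes f :: "'i \<Rightarrow> 'a \<Rightarrow> complex"
  assumes "\<And>i. i \<in> A \<Longrightarrow> set_integrable M S (f i)"
  shows "set_integrable M S (\<lambda>x. \<Sum>i\<in>A. f i x)"
  using assms by (simp add: set_integrable_def scaleR_sum_right)

text \<open>Entry (r, c) of \<open>weight_inner\<close> depends only on row r of the first argument
  and row c of the second, so a scalar form on rows carries all information. Rows are functions on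
  the naturals of which only the values below \<open>N\<close> count.\<close>

definition row_form :: "ereal \<Rightarrow> ereal \<Rightarrow> nat \<Rightarrow> (real \<Rightarrow> complex mat)
    \<Rightarrow> (nat \<Rightarrow> complex poly) \<Rightarrow> (nat \<Rightarrow> complex poly) \<Rightarrow> complex" where
  "row_form x0 x1 N W u v = (LINT x:einterval x0 x1|lborel.
     \<Sum>k<N. \<Sum>l<N. poly (u k) (of_real x) * W x $$ (k, l) * cnj (poly (v l) (of_real x)))"

locale weighted_interval =
  fixes x0 x1 :: ereal and N :: nat and W :: "real \<Rightarrow> complex mat"
  assumes interval: "x0 < x1"
    and W_carrier: "x \<in> einterval x0 x1 \<Longrightarrow> W x \<in> carrier_mat N N"
    and AE_positive_definite:
      "AE x in lborel. x \<in> einterval x0 x1 \<longrightarrow> positive_definite N (W x)"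
    and integrable_moment: "i < N \<Longrightarrow> j < N \<Longrightarrow>
      set_integrable lborel (einterval x0 x1) (\<lambda>x. of_real (x ^ n) * W x $$ (i, j))"

lemma weighted_interval_if_weight:
  "x0 < x1 \<Longrightarrow> weight x0 x1 N W \<Longrightarrow> weighted_interval x0 x1 N W"
  by (simp add: weighted_interval_def weight_def)

context weighted_interval
begin

abbreviation form :: "(nat \<Rightarrow> complex poly) \<Rightarrow> (nat \<Rightarrow> complex poly) \<Rightarrow> complex" where
  "form \<equiv> row_form x0 x1 N W"

lemma integrable_poly_W_poly:
  assumes "k < N" "l < N"
  shows "set_integrable lborel (einterval x0 x1)
    (\<lambda>x. poly p (of_real x) * W x $$ (k, l) * cnj (poly q (of_real x)))"
proof -
  \<comment> \<open>At a real x the conjugate of q(x) is the value of the polynomial with conjugated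
    coefficients. The integrand is therefore one polynomial times an entry of \<open>W\<close>, a
    finite combination of moments.\<close>
  define r where "r = p * map_poly cnj q"
  have "set_integrable lborel (einterval x0 x1)
      (\<lambda>x. \<Sum>i\<le>degree r. coeff r i * (of_real (x ^ i) * W x $$ (k, l)))"
    using assms by (intro set_integrable_sum set_integrable_mult_right integrable_moment) auto
  moreover have "(\<Sum>i\<le>degree r. coeff r i * (of_real (x ^ i) * W x $$ (k, l))) =
      poly p (of_real x) * W x $$ (k, l) * cnj (poly q (of_real x))" for x
  proof -
    have "(\<Sum>i\<le>degree r. coeff r i * (of_real (x ^ i) * W x $$ (k, l))) =
        poly r (of_real x) * W x $$ (k, l)"
      by (simp add: poly_altdef sum_distrib_right mult.assoc)
    also have "poly r (of_real x) = poly p (of_real x) * cnj (poly q (of_real x))"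
      by (simp add: r_def)
    finally show ?thesis by (simp add: mult_ac)
  qed
  ultimately show ?thesis by simp
qed

lemma integrable_form:
  "set_integrable lborel (einterval x0 x1)
    (\<lambda>x. \<Sum>k<N. \<Sum>l<N. poly (u k) (of_real x) * W x $$ (k, l) * cnj (poly (v l) (of_real x)))"
  by (intro set_integrable_sum integrable_poly_W_poly) auto

lemma form_cong:
  assumes "\<And>k. k < N \<Longrightarrow> u k = u' k" "\<And>k. k < N \<Longrightarrow> v k = v' k"
  shows "form u v = form u' v'"
  using assms by (simp add: row_form_def)

lemma form_add_left: "form (\<lambda>k. u k + u' k) v = form u v + form u' v"
  unfolding row_form_def
  by (subst set_integral_add(2)[OF integrable_form integrable_form, symmetric])
     (simp add: algebra_simps sum.distrib)

lemma form_add_right: "form u (\<lambda>k. v k + v' k) = form u v + form u v'"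
  unfolding row_form_def
  by (subst set_integral_add(2)[OF integrable_form integrable_form, symmetric])
     (simp add: algebra_simps sum.distrib)

lemma form_smult_left: "form (\<lambda>k. smult c (u k)) v = c * form u v"
  unfolding row_form_def
  by (subst set_integral_mult_right[symmetric]) (simp add: sum_distrib_left mult_ac)

lemma form_smult_right: "form u (\<lambda>k. smult c (v k)) = cnj c * form u v"
  unfolding row_form_def
  by (subst set_integral_mult_right[symmetric]) (simp add: sum_distrib_left mult_ac)

lemma form_zero_left [simp]: "form (\<lambda>k. 0) v = 0"
  by (simp add: row_form_def)

lemma form_zero_right [simp]: "form u (\<lambda>k. 0) = 0"
  by (simp add: row_form_def)

lemma form_diff_right: "form u (\<lambda>k. v k - v' k) = form u v - form u v'"
  using form_add_right[of u v "\<lambda>k. smult (-1) (v' k)"] form_smult_right[of u "-1" v'] by simp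

lemma form_sum_left:
  "form (\<lambda>k. \<Sum>i\<in>A. smult (c i) (u i k)) v = (\<Sum>i\<in>A. c i * form (u i) v)"
  by (induction A rule: infinite_finite_induct)
     (simp_all add: form_add_left form_smult_left)

lemma form_sum_right:
  "form u (\<lambda>k. \<Sum>i\<in>A. smult (c i) (v i k)) = (\<Sum>i\<in>A. cnj (c i) * form u (v i))"
  by (induction A rule: infinite_finite_induct)
     (simp_all add: form_add_right form_smult_right)

text \<open>Conjugation fixes the real variable x. This symmetry is what carries commutators over to
  the adjoint.\<close>

lemma form_pCons_0: "form (\<lambda>k. pCons 0 (u k)) v = form u (\<lambda>k. pCons 0 (v k))"
  by (simp add: row_form_def mult_ac)

lemma AE_integrand_pos:
  "AE x in lborel. x \<in> einterval x0 x1 \<longrightarrow> (\<exists>k<N. poly (u k) (of_real x) \<noteq> 0) \<longrightarrow>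
    0 < Re (\<Sum>k<N. \<Sum>l<N. poly (u k) (of_real x) * W x $$ (k, l) * cnj (poly (u l) (of_real x)))"
  using AE_positive_definite
proof (rule AE_mp, intro AE_I2 impI)
    fix x assume "x \<in> einterval x0 x1 \<longrightarrow> positive_definite N (W x)" "x \<in> einterval x0 x1"
      and nz: "\<exists>k<N. poly (u k) (of_real x) \<noteq> 0"
    then have pd: "positive_definite N (W x)" by simp
    then have W: "W x \<in> carrier_mat N N" by (simp add: positive_definite_def)
    \<comment> \<open>\<open>positive_definite\<close> speaks about columns and conjugates the left
      factor, whereas here the row \<open>u\<close> stands unconjugated on the left; hence the
      conjugate.\<close>
    define v where "v = Matrix.vec N (\<lambda>k. cnj (poly (u k) (of_real x)))"
    have "v \<noteq> 0\<^sub>v N" using nz by (auto simp: v_def vec_eq_iff)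
    with pd have "0 < Re ((W x *\<^sub>v v) \<bullet>c v)"
      by (simp add: positive_definite_def v_def)
    also have "(W x *\<^sub>v v) \<bullet>c v =
      (\<Sum>k<N. \<Sum>l<N. poly (u k) (of_real x) * W x $$ (k, l) * cnj (poly (u l) (of_real x)))"
      using W by (simp add: scalar_prod_def v_def sum_distrib_left mult_ac conjugate_complex_def
          lessThan_atLeast0)
    finally show "0 < Re (\<Sum>k<N. \<Sum>l<N. poly (u k) (of_real x) * W x $$ (k, l) *
        cnj (poly (u l) (of_real x)))" .
qed

text \<open>A nonempty open interval contains some (a, b) with a < b, which has positive measure.
  Positivity of \<open>W\<close> holds only almost everywhere, so definiteness needs an interval
  that is not null.\<close>

lemma not_AE_notin_interval: "\<not> (AE x in lborel. x \<notin> einterval x0 x1)"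
proof
  assume "AE x in lborel. x \<notin> einterval x0 x1"
  moreover obtain a where a: "x0 < ereal a" "ereal a < x1"
    using ereal_dense2[OF interval] by blast
  moreover obtain b where b: "ereal a < ereal b" "ereal b < x1"
    using ereal_dense2[OF a(2)] by blast
  ultimately have "AE x in lborel. x \<notin> {a<..<b}"
    by (rule_tac AE_mp) (auto intro!: AE_I2 simp: einterval_def intro: less_trans[of x0 "ereal a"]
        less_trans[of _ "ereal b" x1])
  then have "emeasure lborel {a<..<b} = 0"
    by (subst (asm) AE_iff_measurable[where N = "{a<..<b}"]) auto
  with b show False by simp
qed

text \<open>The integrand is almost everywhere nonnegative, so a zero integral makes it vanish
  almost everywhere. A nonzero polynomial \<open>u k\<close> has finitely many zeros, so the
  integrand would be positive almost everywhere on the interval.\<close>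

lemma form_definite:
  assumes "form u u = 0" and "k < N"
  shows "u k = 0"
proof (rule ccontr)
  assume "u k \<noteq> 0"
  define f where "f x = (\<Sum>k<N. \<Sum>l<N. poly (u k) (of_real x) * W x $$ (k, l) *
    cnj (poly (u l) (of_real x)))" for x
  define g where "g x = Re (indicator (einterval x0 x1) x *\<^sub>R f x)" for x :: real
  have int: "integrable lborel (\<lambda>x. indicator (einterval x0 x1) x *\<^sub>R f x)"
    using integrable_form[of u u] by (simp add: set_integrable_def f_def)
  have "integral\<^sup>L lborel g = Re (form u u)"
    using integral_Re[OF int] by (simp add: g_def[abs_def] row_form_def f_def set_lebesgue_integral_def)
  then have g0: "integral\<^sup>L lborel g = 0"
    using assms by simp
  have gint: "integrable lborel g"
    using integrable_Re[OF int] by (simp add: g_def[abs_def])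
  have pos: "AE x in lborel. x \<in> einterval x0 x1 \<longrightarrow> (\<exists>k<N. poly (u k) (of_real x) \<noteq> 0) \<longrightarrow> 0 < Re (f x)"
    unfolding f_def by (rule AE_integrand_pos)
  have "AE x in lborel. 0 \<le> g x"
    using pos
  proof (rule AE_mp, intro AE_I2 impI)
    fix x assume *: "x \<in> einterval x0 x1 \<longrightarrow> (\<exists>k<N. poly (u k) (of_real x) \<noteq> 0) \<longrightarrow> 0 < Re (f x)"
    show "0 \<le> g x"
    proof (cases "x \<in> einterval x0 x1 \<and> (\<exists>k<N. poly (u k) (of_real x) \<noteq> 0)")
      case True
      with * show ?thesis by (simp add: g_def)
    next
      case False
      then show ?thesis by (auto simp: g_def f_def indicator_def)
    qed
  qed
  with g0 gint have "AE x in lborel. g x = 0"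
    using integral_nonneg_eq_0_iff_AE by blast
  moreover have "finite {x::real. poly (u k) (of_real x) = 0}"
    using finite_vimageI[OF poly_roots_finite[OF \<open>u k \<noteq> 0\<close>], of of_real]
    by (simp add: vimage_def inj_on_def)
  then have "AE x in lborel. x \<notin> {x::real. poly (u k) (of_real x) = 0}"
    by (intro AE_not_in finite_imp_null_set_lborel)
  ultimately have "AE x in lborel. x \<notin> einterval x0 x1"
    using pos
  proof eventually_elim
    case (elim x)
    then show ?case using \<open>k < N\<close> by (auto simp: g_def)
  qed
  with not_AE_notin_interval show False by contradiction
qed

lemma index_weight_inner:
  assumes "A \<in> carrier_mat N N" "B \<in> carrier_mat N N" "r < N" "c < N"
  shows "weight_inner x0 x1 N W A B $$ (r, c) = form (\<lambda>k. A $$ (r, k)) (\<lambda>k. B $$ (c, k))"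
proof -
  have "(eval_mat A x * W x * mat_adjoint (eval_mat B x)) $$ (r, c) =
    (\<Sum>k<N. \<Sum>l<N. poly (A $$ (r, k)) (of_real x) * W x $$ (k, l) *
      cnj (poly (B $$ (c, l)) (of_real x)))" if "x \<in> einterval x0 x1" for x
  proof -
    have "(eval_mat A x * W x * mat_adjoint (eval_mat B x)) $$ (r, c) =
      (\<Sum>l<N. \<Sum>k<N. poly (A $$ (r, k)) (of_real x) * W x $$ (k, l) *
        cnj (poly (B $$ (c, l)) (of_real x)))"
      using assms W_carrier[OF that]
      by (simp add: scalar_prod_def eval_mat_def sum_distrib_right lessThan_atLeast0
          conjugate_complex_def)
    also have "\<dots> = (\<Sum>k<N. \<Sum>l<N. poly (A $$ (r, k)) (of_real x) * W x $$ (k, l) *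
        cnj (poly (B $$ (c, l)) (of_real x)))"
      by (rule sum.swap)
    finally show ?thesis .
  qed
  then show ?thesis
    using assms unfolding weight_inner_def mat_integral_def row_form_def
    by (simp, intro set_lebesgue_integral_cong) auto
qed

end

subsection \<open>Sequences of matrix polynomials with invertible leading coefficients\<close>

lemma invertible_mat_iff_det:
  fixes A :: "'a::field mat"
  assumes "A \<in> carrier_mat n n"
  shows "invertible_mat A \<longleftrightarrow> det A \<noteq> 0"
proof
  assume "invertible_mat A"
  then obtain B where B: "A * B = 1\<^sub>m n" "B * A = 1\<^sub>m (dim_row B)"
    using assms by (auto simp: invertible_mat_def inverts_mat_def)
  then have "B \<in> carrier_mat n n"
    using assms by (metis carrier_matD carrier_matI index_mult_mat(2,3) index_one_mat(2,3))
  with B assms have "det A * det B = 1"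
    by (metis det_mult det_one)
  then show "det A \<noteq> 0" by auto
next
  assume "det A \<noteq> 0"
  from det_non_zero_imp_unit[OF assms this]
  obtain B where "B \<in> carrier_mat n n" "A * B = 1\<^sub>m n" "B * A = 1\<^sub>m n"
    by (auto simp: Units_def ring_mat_def)
  with assms show "invertible_mat A"
    by (auto simp: invertible_mat_def inverts_mat_def intro!: exI[of _ B])
qed

lemma invertible_matE:
  fixes A :: "'a::field mat"
  assumes "invertible_mat A" "A \<in> carrier_mat n n"
  obtains B where "B \<in> carrier_mat n n" "A * B = 1\<^sub>m n" "B * A = 1\<^sub>m n"
proof -
  from assms have "det A \<noteq> 0" by (simp add: invertible_mat_iff_det)
  from det_non_zero_imp_unit[OF assms(2) this] that show ?thesis
    by (auto simp: Units_def ring_mat_def)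
qed

lemma det_mat_adjoint:
  fixes A :: "complex mat"
  assumes "A \<in> carrier_mat n n"
  shows "det (mat_adjoint A) = cnj (det A)"
proof -
  interpret cnj: comm_ring_hom cnj by unfold_locales auto
  have "mat_adjoint A = map_mat cnj (transpose_mat A)"
    using assms by (intro eq_matI) (auto simp: conjugate_complex_def)
  then show ?thesis
    using assms by (simp add: cnj.hom_det det_transpose)
qed

definition simple_seq :: "nat \<Rightarrow> (nat \<Rightarrow> complex poly mat) \<Rightarrow> bool" where
  "simple_seq N P \<longleftrightarrow>
    (\<forall>n. P n \<in> carrier_mat N N \<and> degree_le (P n) n \<and> invertible_mat (coeff_mat (P n) n))"

lemma simple_seq_if_mvop: "mvop x0 x1 N W P \<Longrightarrow> simple_seq N P"
  by (simp add: mvop_def simple_seq_def)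

lemma simple_seq_carrier: "simple_seq N P \<Longrightarrow> P n \<in> carrier_mat N N"
  by (simp add: simple_seq_def)

lemma simple_seq_coeff_eq_0:
  "simple_seq N P \<Longrightarrow> r < N \<Longrightarrow> k < N \<Longrightarrow> n < i \<Longrightarrow> coeff (P n $$ (r, k)) i = 0"
  unfolding simple_seq_def degree_le_def carrier_mat_def
  by (intro coeff_eq_0) (metis (mono_tags, lifting) le_less_trans mem_Collect_eq)

lemma simple_seq_lead:
  assumes "simple_seq N P"
  obtains B where
    "\<forall>r<N. \<forall>c<N.
      (\<Sum>k<N. coeff (P n $$ (r, k)) n * B $$ (k, c)) = (if r = c then 1 else 0)"
    "\<forall>r<N. \<forall>c<N.
      (\<Sum>k<N. B $$ (r, k) * coeff (P n $$ (k, c)) n) = (if r = c then 1 else 0)"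
proof -
  let ?A = "coeff_mat (P n) n"
  have P: "P n \<in> carrier_mat N N" and inv: "invertible_mat ?A"
    using assms by (auto simp: simple_seq_def)
  have A: "?A \<in> carrier_mat N N" using P by (simp add: coeff_mat_def)
  obtain B where B: "B \<in> carrier_mat N N" "?A * B = 1\<^sub>m N" "B * ?A = 1\<^sub>m N"
    using invertible_matE[OF inv A] by blast
  show ?thesis
  proof
    have "(?A * B) $$ (r, c) = (if r = c then 1 else 0)" "(B * ?A) $$ (r, c) = (if r = c then 1 else 0)"
      if "r < N" "c < N" for r c
      using B that by auto
    then show "\<forall>r<N. \<forall>c<N.
      (\<Sum>k<N. coeff (P n $$ (r, k)) n * B $$ (k, c)) = (if r = c then 1 else 0)"
      and "\<forall>r<N. \<forall>c<N.
      (\<Sum>k<N. B $$ (r, k) * coeff (P n $$ (k, c)) n) = (if r = c then 1 else 0)"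
      using P B(1) by (auto simp: scalar_prod_def coeff_mat_def lessThan_atLeast0)
  qed
qed

text \<open>The rows of an invertible leading coefficient are linearly independent: multiply by its
  right inverse \<open>B\<close>.\<close>

lemma simple_seq_independent:
  assumes "simple_seq N P" and "\<And>k. k < N \<Longrightarrow> (\<Sum>r<N. b r * coeff (P n $$ (r, k)) n) = 0"
    and "s < N"
  shows "b s = 0"
proof -
  obtain B where B: "\<forall>r<N. \<forall>c<N.
      (\<Sum>k<N. coeff (P n $$ (r, k)) n * B $$ (k, c)) = (if r = c then 1 else 0)"
    and "\<forall>r<N. \<forall>c<N.
      (\<Sum>k<N. B $$ (r, k) * coeff (P n $$ (k, c)) n) = (if r = c then 1 else 0)"
    by (rule simple_seq_lead[OF assms(1), of n])
  have "b s = (\<Sum>r<N. b r * (if r = s then 1 else 0))"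
    using assms(3) by (simp add: if_distrib[of "\<lambda>x. _ * x"] cong: if_cong)
  also have "\<dots> = (\<Sum>r<N. b r * (\<Sum>k<N. coeff (P n $$ (r, k)) n * B $$ (k, s)))"
    using B assms(3) by simp
  also have "\<dots> = (\<Sum>k<N. (\<Sum>r<N. b r * coeff (P n $$ (r, k)) n) * B $$ (k, s))"
    by (simp add: sum_distrib_left sum_distrib_right mult_ac) (rule sum.swap)
  also have "\<dots> = 0" using assms(2) by simp
  finally show ?thesis .
qed

text \<open>Induction on the exclusive degree bound: a combination of the rows of \<open>P n\<close>
  cancels the coefficients of x^n, and the remainder \<open>v'\<close> lies below n.\<close>

lemma simple_seq_span_below:
  assumes "simple_seq N P" and "\<And>k i. k < N \<Longrightarrow> n \<le> i \<Longrightarrow> coeff (v k) i = 0"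
  shows "\<exists>c. \<forall>k<N. v k = (\<Sum>m<n. \<Sum>r<N. smult (c m r) (P m $$ (r, k)))"
  using assms(2)
proof (induction n arbitrary: v)
  case 0
  then show ?case by (auto intro!: poly_eqI)
next
  case (Suc n)
  obtain B where "\<forall>r<N. \<forall>c<N.
      (\<Sum>k<N. coeff (P n $$ (r, k)) n * B $$ (k, c)) = (if r = c then 1 else 0)"
    and B: "\<forall>r<N. \<forall>c<N.
      (\<Sum>k<N. B $$ (r, k) * coeff (P n $$ (k, c)) n) = (if r = c then 1 else 0)"
    by (rule simple_seq_lead[OF assms(1), of n])
  \<comment> \<open>The row of coefficients of x^n times the inverse of the leading coefficient of
    \<open>P n\<close>.\<close>
  define b where "b r = (\<Sum>k<N. coeff (v k) n * B $$ (k, r))" for r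
  have b: "(\<Sum>r<N. b r * coeff (P n $$ (r, k)) n) = coeff (v k) n" if "k < N" for k
  proof -
    have "(\<Sum>r<N. b r * coeff (P n $$ (r, k)) n) =
        (\<Sum>r<N. \<Sum>j<N. coeff (v j) n * (B $$ (j, r) * coeff (P n $$ (r, k)) n))"
      by (simp add: b_def sum_distrib_right mult.assoc)
    also have "\<dots> = (\<Sum>j<N. coeff (v j) n * (\<Sum>r<N. B $$ (j, r) * coeff (P n $$ (r, k)) n))"
      by (subst sum.swap) (simp add: sum_distrib_left)
    also have "\<dots> = (\<Sum>j<N. coeff (v j) n * (if j = k then 1 else 0))"
      using B that by simp
    also have "\<dots> = coeff (v k) n"
      using that by (simp add: if_distrib[of "\<lambda>x. _ * x"] cong: if_cong)
    finally show ?thesis .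
  qed
  define v' where "v' k = v k - (\<Sum>r<N. smult (b r) (P n $$ (r, k)))" for k
  have "coeff (v' k) i = 0" if "k < N" "n \<le> i" for k i
  proof (cases "i = n")
    case True
    with b that show ?thesis by (simp add: v'_def coeff_sum)
  next
    case False
    with that Suc.prems[of k i] show ?thesis
      by (simp add: v'_def coeff_sum simple_seq_coeff_eq_0[OF assms(1)])
  qed
  then have "\<exists>c. \<forall>k<N. v' k = (\<Sum>m<n. \<Sum>r<N. smult (c m r) (P m $$ (r, k)))"
    by (rule Suc.IH)
  then obtain c where c: "\<And>k. k < N \<Longrightarrow> v' k = (\<Sum>m<n. \<Sum>r<N. smult (c m r) (P m $$ (r, k)))"
    by blast
  have "v k = (\<Sum>m<Suc n. \<Sum>r<N. smult ((c(n := b)) m r) (P m $$ (r, k)))" if "k < N" for k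
    using c[OF that] by (simp add: v'_def diff_eq_eq)
  then show ?case by blast
qed

lemma simple_seq_span:
  assumes "simple_seq N P"
  obtains c n where "\<And>k. k < N \<Longrightarrow>
    v k = (\<Sum>i\<in>{..<n} \<times> {..<N}. smult (c i) (P (fst i) $$ (snd i, k)))"
proof -
  \<comment> \<open>A strict bound for all degrees; \<open>insert 0\<close> keeps the maximum
    meaningful for \<open>N = 0\<close>.\<close>
  define n where "n = Suc (Max (insert 0 ((\<lambda>k. degree (v k)) ` {..<N})))"
  have "degree (v k) < n" if "k < N" for k
    unfolding n_def using that by (intro le_imp_less_Suc Max_ge) auto
  then have "coeff (v k) i = 0" if "k < N" "n \<le> i" for k i
    using that by (intro coeff_eq_0) (meson less_le_trans)
  then have "\<exists>c. \<forall>k<N. v k = (\<Sum>m<n. \<Sum>r<N. smult (c m r) (P m $$ (r, k)))"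
    by (rule simple_seq_span_below[OF assms])
  then obtain c where "\<And>k. k < N \<Longrightarrow> v k = (\<Sum>m<n. \<Sum>r<N. smult (c m r) (P m $$ (r, k)))"
    by blast
  then show ?thesis
    by (intro that[of "\<lambda>i. c (fst i) (snd i)" n])
       (simp add: sum.cartesian_product case_prod_beta)
qed

section \<open>Operators acting on rows of polynomials\<close>

definition row_act :: "nat \<Rightarrow> (nat \<Rightarrow> complex poly) \<Rightarrow> dop mat \<Rightarrow> nat \<Rightarrow> complex poly" where
  "row_act n u D c = (\<Sum>k<n. dop_act (u k) (D $$ (k, c)))"

lemma index_dop_mat_act:
  "A \<in> carrier_mat m n \<Longrightarrow> r < m \<Longrightarrow> c < dim_col D \<Longrightarrow>
    dop_mat_act A D $$ (r, c) = row_act n (\<lambda>k. A $$ (r, k)) D c"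
  by (simp add: dop_mat_act_def row_act_def)

lemma row_act_cong: "(\<And>k. k < n \<Longrightarrow> u k = v k) \<Longrightarrow> row_act n u D c = row_act n v D c"
  by (simp add: row_act_def)

lemma dop_act_sum_smult:
  "dop_act (\<Sum>i\<in>A. smult (a i) (f i)) e = (\<Sum>i\<in>A. smult (a i) (dop_act (f i) e))"
  by (simp add: dop_act_sum_left dop_act_smult_left)

lemma row_act_sum:
  "row_act n (\<lambda>k. \<Sum>i\<in>A. smult (a i) (u i k)) D c = (\<Sum>i\<in>A. smult (a i) (row_act n (u i) D c))"
  unfolding row_act_def dop_act_sum_smult
  by (subst sum.swap) (simp add: smult_sum2)

lemma row_act_pCons_0:
  assumes "D \<in> carrier_mat n m" "c < m"
  shows "row_act n (\<lambda>k. pCons 0 (u k)) D c =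
    pCons 0 (row_act n u D c) + row_act n u (map_mat pderiv D) c"
  using assms by (simp add: row_act_def dop_act_pCons_0 sum.distrib pCons_0_sum)

lemma map_mat_power:
  fixes f :: "'a \<Rightarrow> 'a"
  shows "((map_mat f) ^^ k) D = map_mat (f ^^ k) D"
  by (induction k) (auto simp: mat_eq_iff)

lemma pderiv_power_eq_0:
  fixes e :: dop
  assumes "degree e < K"
  shows "(pderiv ^^ K) e = 0"
  using assms
proof (induction K arbitrary: e)
  case (Suc K)
  show ?case
  proof (cases "degree e = 0")
    case True
    have "(pderiv ^^ K) 0 = (0::dop)" by (induction K) simp_all
    moreover have "pderiv e = 0" using True by (simp add: pderiv_eq_0_iff)
    ultimately show ?thesis by (simp add: funpow_Suc_right del: funpow.simps)
  next
    case False
    with Suc show ?thesis by (simp add: funpow_Suc_right degree_pderiv del: funpow.simps)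
  qed
qed simp

text \<open>Each \<open>pderiv\<close> lowers the order in \<partial>, so a number \<open>K\<close>
  above the orders of all entries suffices.\<close>

lemma dop_mat_pderiv_nilpotent:
  fixes D :: "dop mat"
  assumes "D \<in> carrier_mat n m"
  shows "\<exists>K. (map_mat pderiv ^^ K) D = 0\<^sub>m n m"
proof
  define K where "K = Suc (Max (insert 0 ((\<lambda>(i, j). degree (D $$ (i, j))) ` ({..<n} \<times> {..<m}))))"
  have "degree (D $$ (i, j)) < K" if "i < n" "j < m" for i j
    unfolding K_def using that
    by (intro le_imp_less_Suc Max_ge) (auto intro!: insertI2 image_eqI[of _ _ "(i, j)"])
  then show "(map_mat pderiv ^^ K) D = 0\<^sub>m n m"
    using assms by (auto simp: map_mat_power mat_eq_iff pderiv_power_eq_0)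
qed

lemma row_act_row_eq:
  assumes "Q \<in> carrier_mat m d" "V \<in> carrier_mat d N" "L \<in> carrier_mat m N'" "P \<in> carrier_mat N' N"
    and "dop_mat_act Q V = const_mat L * P" "t < m" "c < N"
  shows "row_act d (\<lambda>k. Q $$ (t, k)) V c = (\<Sum>q<N'. smult (L $$ (t, q)) (P $$ (q, c)))"
proof -
  have "row_act d (\<lambda>k. Q $$ (t, k)) V c = dop_mat_act Q V $$ (t, c)"
    using assms(2,7) by (simp add: index_dop_mat_act[OF assms(1,6)])
  also have "\<dots> = (\<Sum>q<N'. smult (L $$ (t, q)) (P $$ (q, c)))"
    using assms by (simp add: const_mat_def scalar_prod_def lessThan_atLeast0)
  finally show ?thesis .
qed

lemma sum_lessThan_add:
  fixes f :: "nat \<Rightarrow> 'a::comm_monoid_add"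
  shows "(\<Sum>k<m + n. f k) = (\<Sum>k<m. f k) + (\<Sum>k<n. f (m + k))"
  by (induction n) (simp_all add: add_ac)

subsection \<open>The adjoint operator\<close>

definition unit_row :: "nat \<Rightarrow> complex poly \<Rightarrow> nat \<Rightarrow> complex poly" where
  "unit_row k f i = (if i = k then f else 0)"

definition row_shift_comm ::
  "((nat \<Rightarrow> complex poly) \<Rightarrow> nat \<Rightarrow> complex poly) \<Rightarrow> (nat \<Rightarrow> complex poly) \<Rightarrow> nat \<Rightarrow> complex poly" where
  "row_shift_comm E v k = E (\<lambda>i. pCons 0 (v i)) k - pCons 0 (E v k)"

text \<open>Multiplication by x keeps a row supported in position k. Commutators of a map on rows
  can thus be computed entry by entry, which reduces the matrix case to the scalar one.\<close>

lemma row_shift_comm_unit_row: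
  "(row_shift_comm ^^ m) E (unit_row k f) c = (shift_comm ^^ m) (\<lambda>g. E (unit_row k g) c) f"
proof (induction m arbitrary: f)
  case (Suc m)
  have "(\<lambda>i. pCons 0 (unit_row k f i)) = unit_row k (pCons 0 f)"
    by (auto simp: unit_row_def)
  with Suc show ?case by (simp add: row_shift_comm_def shift_comm_def)
qed simp

text \<open>A kernel vector \<open>v\<close> of the Gram matrix yields a combination
  \<open>u\<close> of the rows of \<open>P n\<close> with \<open>form u u = 0\<close>. Definiteness
  gives \<open>u = 0\<close>, and independence of the leading rows gives \<open>v = 0\<close>. The
  coefficients are conjugated because the form is conjugate-linear in its second argument.\<close>

lemma (in weighted_interval) gram_invertible:
  assumes P: "simple_seq N P"
  shows "invertible_mat (weight_inner x0 x1 N W (P n) (P n))"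
proof -
  define G where "G = weight_inner x0 x1 N W (P n) (P n)"
  have G: "G \<in> carrier_mat N N" by (simp add: G_def weight_inner_def mat_integral_def)
  let ?r = "\<lambda>r k. P n $$ (r, k)"
  have ind: "G $$ (r, c) = form (?r r) (?r c)" if "r < N" "c < N" for r c
    using that simple_seq_carrier[OF P] by (simp add: G_def index_weight_inner)
  have "v = 0\<^sub>v N" if v: "v \<in> carrier_vec N" "G *\<^sub>v v = 0\<^sub>v N" for v
  proof -
    define u where "u k = (\<Sum>c<N. smult (cnj (v $ c)) (?r c k))" for k
    have "form (?r r) u = 0" if "r < N" for r
    proof -
      have "form (?r r) u = (\<Sum>c<N. G $$ (r, c) * v $ c)"
        unfolding u_def form_sum_right using that by (simp add: ind mult.commute)
      also have "\<dots> = (G *\<^sub>v v) $ r"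
        using G v(1) that by (simp add: scalar_prod_def lessThan_atLeast0)
      finally show ?thesis using v(2) that by simp
    qed
    then have "form u u = 0"
      unfolding u_def form_sum_left by (simp add: u_def)
    then have "u k = 0" if "k < N" for k
      using form_definite that by blast
    then have "coeff (u k) n = 0" if "k < N" for k
      using that by simp
    then have "cnj (v $ s) = 0" if "s < N" for s
      using simple_seq_independent[OF P _ that, of "\<lambda>c. cnj (v $ c)" n]
      by (simp add: u_def coeff_sum)
    with v(1) show ?thesis by auto
  qed
  then have "det G \<noteq> 0"
    using det_0_iff_vec_prod_zero[OF G] by blast
  with G show ?thesis
    using invertible_mat_iff_det unfolding G_def by blast
qed

locale two_weighted_intervals =
  Z: weighted_interval x0 x1 d Z + W: weighted_interval x0 x1 N W
  for x0 x1 d N Z W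
begin

text \<open>Symmetry of x moves the commutator from \<open>E\<close> to \<open>V\<close> at the cost
  of a sign. The scalar \<open>s\<close> lets the accumulated signs pass through the
  iteration.\<close>

lemma adjoint_row_shift_comm:
  assumes V: "V \<in> carrier_mat d N"
    and adj: "\<And>u v. Z.form u (E v) = s * W.form (row_act d u V) v"
  shows "Z.form u (row_shift_comm E v) = - s * W.form (row_act d u (map_mat pderiv V)) v"
proof -
  let ?X = "\<lambda>u k. pCons 0 (u k)"
  have "Z.form u (row_shift_comm E v) = Z.form u (E (?X v)) - Z.form u (?X (E v))"
    by (simp add: row_shift_comm_def[abs_def] Z.form_diff_right)
  also have "\<dots> = Z.form u (E (?X v)) - Z.form (?X u) (E v)"
    by (simp add: Z.form_pCons_0)
  also have "\<dots> = s * (W.form (?X (row_act d u V)) v - W.form (row_act d (?X u) V) v)"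
    by (simp add: adj W.form_pCons_0 algebra_simps)
  also have "W.form (row_act d (?X u) V) v =
      W.form (\<lambda>c. ?X (row_act d u V) c + row_act d u (map_mat pderiv V) c) v"
    by (rule W.form_cong) (simp_all add: row_act_pCons_0[OF V])
  finally show ?thesis by (simp only: W.form_add_left) simp
qed

lemma adjoint_row_shift_comm_power:
  assumes V: "V \<in> carrier_mat d N"
    and adj: "\<And>u v. Z.form u (E v) = W.form (row_act d u V) v"
  shows "Z.form u ((row_shift_comm ^^ m) E v) =
    (- 1) ^ m * W.form (row_act d u ((map_mat pderiv ^^ m) V)) v"
proof (induction m arbitrary: u v)
  case 0
  then show ?case by (simp add: adj)
next
  case (Suc m)
  have "(map_mat pderiv ^^ m) V \<in> carrier_mat d N"
    using V by (simp add: map_mat_power)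
  from adjoint_row_shift_comm[OF this Suc.IH] show ?case by simp
qed

text \<open>\<open>E\<close> is any function adjoint to \<open>V\<close>. Definiteness of the form
  of \<open>Z\<close> determines its values, hence makes it linear, and the finite order of
  \<open>V\<close> kills its high commutators. Each map from entry k of the argument to entry c of
  the value is then a scalar differential operator, and these form the matrix
  \<open>e\<close>.\<close>

lemma adjoint_is_dop:
  assumes V: "V \<in> carrier_mat d N"
    and adj: "\<And>u v. Z.form u (E v) = W.form (row_act d u V) v"
  shows "\<exists>e\<in>carrier_mat N d. \<forall>v. \<forall>c<d. E v c = row_act N v e c"
proof -
  have unique: "g c = h c" if "\<And>u. Z.form u g = Z.form u h" "c < d" for g h c
    using Z.form_definite[of "\<lambda>k. g k - h k" c] that by (simp add: Z.form_diff_right)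
  obtain K where K: "(map_mat pderiv ^^ K) V = 0\<^sub>m d N"
    using dop_mat_pderiv_nilpotent[OF V] by blast
  have "Z.form u ((row_shift_comm ^^ K) E v) = 0" for u v
  proof -
    have "W.form (row_act d u (0\<^sub>m d N)) v = W.form (\<lambda>k. 0) v"
      by (rule W.form_cong) (simp_all add: row_act_def)
    then show ?thesis
      by (simp add: adjoint_row_shift_comm_power[OF V adj] K)
  qed
  then have nil: "(row_shift_comm ^^ K) E v c = 0" if "c < d" for v c
    using that Z.form_definite by blast
  have ex: "\<exists>e. \<forall>f. E (unit_row k f) c = dop_act f e" if "k < N" "c < d" for k c
  proof (rule dop_exists_if_shift_comm_nilpotent)
    show "E (unit_row k (f + g)) c = E (unit_row k f) c + E (unit_row k g) c" for f g
    proof -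
      have "unit_row k (f + g) = (\<lambda>i. unit_row k f i + unit_row k g i)"
        by (auto simp: unit_row_def)
      then show ?thesis
        using unique[of "E (unit_row k (f + g))" "\<lambda>c. E (unit_row k f) c + E (unit_row k g) c" c] that
        by (simp add: adj Z.form_add_right W.form_add_right)
    qed
    show "E (unit_row k (smult a f)) c = smult a (E (unit_row k f) c)" for a f
    proof -
      have "unit_row k (smult a f) = (\<lambda>i. smult a (unit_row k f i))"
        by (auto simp: unit_row_def)
      then show ?thesis
        using unique[of "E (unit_row k (smult a f))" "\<lambda>c. smult a (E (unit_row k f) c)" c] that
        by (simp add: adj Z.form_smult_right W.form_smult_right)
    qed
    show "(shift_comm ^^ K) (\<lambda>f. E (unit_row k f) c) f = 0" for f
      using nil[OF that(2)] by (simp flip: row_shift_comm_unit_row)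
  qed
  then obtain h where h: "\<And>k c f. k < N \<Longrightarrow> c < d \<Longrightarrow> E (unit_row k f) c = dop_act f (h k c)"
    by metis
  define e where "e = Matrix.mat N d (\<lambda>(k, c). h k c)"
  have e: "E (unit_row k f) c = dop_act f (e $$ (k, c))" if "k < N" "c < d" for k c f
    using h that by (simp add: e_def)
  have "E v c = row_act N v e c" if "c < d" for v c
  proof -
    \<comment> \<open>Additivity over the entries of \<open>v\<close>, again by comparing forms. The
      factors \<open>smult 1\<close> only give the sums the shape of
      \<open>form_sum_right\<close>.\<close>
    have "Z.form u (E v) = Z.form u (\<lambda>c. \<Sum>k<N. smult 1 (E (unit_row k (v k)) c))" for u
    proof -
      have "Z.form u (\<lambda>c. \<Sum>k<N. smult 1 (E (unit_row k (v k)) c)) =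
          W.form (row_act d u V) (\<lambda>i. \<Sum>k<N. smult 1 (unit_row k (v k) i))"
        by (simp only: Z.form_sum_right W.form_sum_right adj)
      also have "\<dots> = W.form (row_act d u V) v"
        by (rule W.form_cong) (simp_all add: unit_row_def)
      finally show ?thesis by (simp add: adj)
    qed
    from unique[OF this that] show ?thesis
      using that by (simp add: e row_act_def)
  qed
  moreover have "e \<in> carrier_mat N d" by (simp add: e_def)
  ultimately show ?thesis by blast
qed

text \<open>The adjoint is prescribed on the basis of rows of the \<open>P m\<close> and extended to
  all rows through the spanning property. Its adjointness then makes it a differential
  operator.\<close>

lemma adjoint_exists:
  assumes P: "mvop x0 x1 N W P" and Q: "mvop x0 x1 d Z Q"
    and V: "V \<in> carrier_mat d N"
    and L: "\<And>n. L n \<in> carrier_mat d N" "\<And>n. dop_mat_act (Q n) V = const_mat (L n) * P n"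
  obtains E B where "E \<in> carrier_mat N d" "\<And>n. B n \<in> carrier_mat N d"
    "\<And>n. dop_mat_act (P n) E = const_mat (B n) * Q n"
    "\<And>n. invertible_mat (L n) \<Longrightarrow> invertible_mat (B n)"
proof -
  have sP: "simple_seq N P" and sQ: "simple_seq d Q"
    using P Q by (auto simp: simple_seq_if_mvop)
  note cP = simple_seq_carrier[OF sP] and cQ = simple_seq_carrier[OF sQ]
  define H where "H m = weight_inner x0 x1 d Z (Q m) (Q m)" for m
  define G where "G m = weight_inner x0 x1 N W (P m) (P m)" for m
  have H: "H m \<in> carrier_mat d d" and G: "G m \<in> carrier_mat N N" for m
    by (simp_all add: H_def G_def weight_inner_def mat_integral_def)
  have invH: "invertible_mat (H m)" and invG: "invertible_mat (G m)" for m
    unfolding H_def G_def using Z.gram_invertible[OF sQ] W.gram_invertible[OF sP] by auto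
  have "\<exists>Y. Y \<in> carrier_mat d d \<and> H m * Y = 1\<^sub>m d" for m
    using invertible_matE[OF invH H] by blast
  then obtain Hi where Hi: "\<And>m. Hi m \<in> carrier_mat d d" "\<And>m. H m * Hi m = 1\<^sub>m d"
    by metis
  \<comment> \<open>Pairing Q_m V = L_m P_m with P_m gives L_m G_m, while pairing Q_m with B_m Q_m
    gives H_m times the adjoint of B_m. Equating the two forces this \<open>X m\<close> as the
    adjoint of \<open>B m\<close>.\<close>
  define X where "X m = Hi m * (L m * G m)" for m
  define B where "B m = mat_adjoint (X m)" for m
  have X: "X m \<in> carrier_mat d N" for m
    using Hi L(1) G by (metis X_def mult_carrier_mat)
  then have B: "B m \<in> carrier_mat N d" for m
    unfolding B_def carrier_mat_def by simp
  have HX: "H m * X m = L m * G m" for m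
  proof -
    have "H m * X m = H m * Hi m * (L m * G m)"
      unfolding X_def by (rule assoc_mult_mat[OF H Hi(1) mult_carrier_mat[OF L(1) G], symmetric])
    then show ?thesis using left_mult_one_mat[OF mult_carrier_mat[OF L(1) G]] by (simp add: Hi(2))
  qed
  have formQ: "Z.form (\<lambda>k. Q m $$ (r, k)) (\<lambda>k. Q n $$ (c, k)) = (if m = n then H m $$ (r, c) else 0)"
    if "r < d" "c < d" for m n r c
    using Z.index_weight_inner[OF cQ cQ that, of m n] that Q by (auto simp: H_def mvop_def)
  have formP: "W.form (\<lambda>k. P m $$ (r, k)) (\<lambda>k. P n $$ (c, k)) = (if m = n then G m $$ (r, c) else 0)"
    if "r < N" "c < N" for m n r c
    using W.index_weight_inner[OF cP cP that, of m n] that P by (auto simp: G_def mvop_def)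
  have actV: "row_act d (\<lambda>k. Q n $$ (t, k)) V c = (\<Sum>q<N. smult (L n $$ (t, q)) (P n $$ (q, c)))"
    if "t < d" "c < N" for n t c
    by (rule row_act_row_eq[OF cQ V L(1) cP L(2) that])
  \<comment> \<open>Row s of B_m Q_m, the intended image of row s of \<open>P m\<close>.\<close>
  define g where "g m s k = (\<Sum>t<d. smult (B m $$ (s, t)) (Q m $$ (t, k)))" for m s k
  have basis: "Z.form (\<lambda>k. Q n $$ (t, k)) (g m s) =
      W.form (row_act d (\<lambda>k. Q n $$ (t, k)) V) (\<lambda>k. P m $$ (s, k))"
    if "t < d" "s < N" for n t m s
  proof -
    have "Z.form (\<lambda>k. Q n $$ (t, k)) (g m s) =
        (\<Sum>q<d. cnj (B m $$ (s, q)) * (if n = m then H n $$ (t, q) else 0))"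
      unfolding g_def Z.form_sum_right using that by (simp add: formQ)
    also have "\<dots> = (if n = m then (H m * X m) $$ (t, s) else 0)"
      using that X[of m] H[of m]
      by (simp add: B_def scalar_prod_def lessThan_atLeast0 conjugate_complex_def mult.commute)
    also have "\<dots> = (if n = m then (L m * G m) $$ (t, s) else 0)"
      by (simp add: HX)
    also have "\<dots> = (\<Sum>q<N. L n $$ (t, q) * (if n = m then G n $$ (q, s) else 0))"
      using that L(1)[of m] G[of m] by (simp add: scalar_prod_def lessThan_atLeast0)
    also have "\<dots> = W.form (\<lambda>c. \<Sum>q<N. smult (L n $$ (t, q)) (P n $$ (q, c))) (\<lambda>k. P m $$ (s, k))"
      unfolding W.form_sum_left using that by (simp add: formP)
    also have "\<dots> = W.form (row_act d (\<lambda>k. Q n $$ (t, k)) V) (\<lambda>k. P m $$ (s, k))"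
      using that by (intro W.form_cong) (simp_all add: actV)
    finally show ?thesis .
  qed
  \<comment> \<open>Linearity in the first argument extends the relation from the rows of the
    \<open>Q n\<close> to every \<open>u\<close>.\<close>
  have row: "Z.form u (g m s) = W.form (row_act d u V) (\<lambda>k. P m $$ (s, k))" if s: "s < N" for u m s
  proof -
    obtain c n where c: "\<And>k. k < d \<Longrightarrow>
        u k = (\<Sum>i\<in>{..<n} \<times> {..<d}. smult (c i) (Q (fst i) $$ (snd i, k)))"
      using simple_seq_span[OF sQ] by blast
    let ?u = "\<lambda>k. \<Sum>i\<in>{..<n} \<times> {..<d}. smult (c i) (Q (fst i) $$ (snd i, k))"
    have "Z.form u (g m s) = Z.form ?u (g m s)"
      by (rule Z.form_cong) (simp_all add: c)
    also have "\<dots> = (\<Sum>i\<in>{..<n} \<times> {..<d}. c i *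
        W.form (row_act d (\<lambda>k. Q (fst i) $$ (snd i, k)) V) (\<lambda>k. P m $$ (s, k)))"
      unfolding Z.form_sum_left using s by (intro sum.cong) (auto simp: basis)
    also have "\<dots> = W.form (row_act d ?u V) (\<lambda>k. P m $$ (s, k))"
      by (subst W.form_sum_left[symmetric]) (simp flip: row_act_sum)
    also have "row_act d ?u V = row_act d u V"
      by (intro ext row_act_cong) (simp add: c)
    finally show ?thesis .
  qed
  \<comment> \<open>The same extension in the second argument, where the form is conjugate-linear.
    It yields for each \<open>v\<close> some adjoint value, from which the function \<open>F\<close>
    is chosen.\<close>
  have "\<exists>h. \<forall>u. Z.form u h = W.form (row_act d u V) v" for v
  proof -
    obtain c n where c: "\<And>k. k < N \<Longrightarrow>
        v k = (\<Sum>i\<in>{..<n} \<times> {..<N}. smult (c i) (P (fst i) $$ (snd i, k)))"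
      using simple_seq_span[OF sP] by blast
    have "Z.form u (\<lambda>k. \<Sum>i\<in>{..<n} \<times> {..<N}. smult (c i) (g (fst i) (snd i) k)) =
        W.form (row_act d u V) v" for u
    proof -
      have "Z.form u (\<lambda>k. \<Sum>i\<in>{..<n} \<times> {..<N}. smult (c i) (g (fst i) (snd i) k)) =
          (\<Sum>i\<in>{..<n} \<times> {..<N}. cnj (c i) *
            W.form (row_act d u V) (\<lambda>k. P (fst i) $$ (snd i, k)))"
        unfolding Z.form_sum_right by (intro sum.cong) (auto simp: row)
      also have "\<dots> = W.form (row_act d u V)
          (\<lambda>k. \<Sum>i\<in>{..<n} \<times> {..<N}. smult (c i) (P (fst i) $$ (snd i, k)))"
        by (simp add: W.form_sum_right)
      also have "\<dots> = W.form (row_act d u V) v"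
        by (rule W.form_cong) (simp_all add: c)
      finally show ?thesis .
    qed
    then show ?thesis by blast
  qed
  then obtain F where F: "\<And>u v. Z.form u (F v) = W.form (row_act d u V) v"
    by metis
  obtain E where E: "E \<in> carrier_mat N d" "\<And>v c. c < d \<Longrightarrow> F v c = row_act N v E c"
    using adjoint_is_dop[OF V F] by blast
  show ?thesis
  proof
    show "E \<in> carrier_mat N d" "B n \<in> carrier_mat N d" for n
      by fact+
    show "dop_mat_act (P n) E = const_mat (B n) * Q n" for n
    proof (rule eq_matI)
      show "dim_row (dop_mat_act (P n) E) = dim_row (const_mat (B n) * Q n)"
        "dim_col (dop_mat_act (P n) E) = dim_col (const_mat (B n) * Q n)"
        using E(1) B[of n] cP[of n] cQ[of n] by (simp_all add: dop_mat_act_def const_mat_def)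
      fix s c assume "s < dim_row (const_mat (B n) * Q n)" "c < dim_col (const_mat (B n) * Q n)"
      then have sc: "s < N" "c < d"
        using B[of n] cQ[of n] by (auto simp: const_mat_def)
      \<comment> \<open>\<open>F\<close> was obtained by choice; definiteness shows that on the rows
        of \<open>P n\<close> it takes the prescribed values.\<close>
      have "Z.form u (F (\<lambda>k. P n $$ (s, k))) = Z.form u (g n s)" for u
        using sc by (simp add: F row)
      then have "F (\<lambda>k. P n $$ (s, k)) c = g n s c"
        using Z.form_definite[of "\<lambda>k. F (\<lambda>k. P n $$ (s, k)) k - g n s k" c] sc
        by (simp add: Z.form_diff_right)
      then show "dop_mat_act (P n) E $$ (s, c) = (const_mat (B n) * Q n) $$ (s, c)"
        using sc E B[of n] cQ[of n]
        by (simp add: index_dop_mat_act[OF cP] g_def const_mat_def scalar_prod_def lessThan_atLeast0)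
    qed
    show "invertible_mat (B n)" if inv: "invertible_mat (L n)" for n
    proof -
      \<comment> \<open>\<open>invertible_mat\<close> includes being square, so determinants become
        available for all matrices involved.\<close>
      have "d = N" using inv L(1)[of n] by (auto simp: invertible_mat_def)
      note car = H[of n] G[of n] X[of n] L(1)[of n] B[of n]
      have "det (H n) * det (X n) = det (L n) * det (G n)"
        using HX[of n] car det_mult unfolding \<open>d = N\<close> by metis
      moreover have "det (L n) \<noteq> 0" "det (G n) \<noteq> 0"
        using inv invG[of n] car unfolding \<open>d = N\<close> by (simp_all add: invertible_mat_iff_det)
      ultimately have "det (X n) \<noteq> 0" by auto
      then show ?thesis
        using car unfolding \<open>d = N\<close> by (simp add: invertible_mat_iff_det B_def det_mat_adjoint)
    qed
  qed
qed

end

subsection \<open>Degree-preserving operators\<close>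

text \<open>The reason why \<open>V\<close> does not raise degrees: \<open>u\<close> is a
  combination of rows of \<open>Q m\<close> with m < n, and \<open>V\<close> sends these to
  combinations of rows of \<open>P m\<close>, of degree at most m.\<close>

lemma coeff_row_act_eq_0:
  assumes Q: "simple_seq d Q" and P: "simple_seq N P" and V: "V \<in> carrier_mat d N"
    and A: "\<And>n. A n \<in> carrier_mat d N" "\<And>n. dop_mat_act (Q n) V = const_mat (A n) * P n"
    and u: "\<And>k i. k < d \<Longrightarrow> n \<le> i \<Longrightarrow> coeff (u k) i = 0" and "c < N" "n \<le> i"
  shows "coeff (row_act d u V c) i = 0"
proof -
  note cP = simple_seq_carrier[OF P] and cQ = simple_seq_carrier[OF Q]
  have "\<exists>b. \<forall>k<d. u k = (\<Sum>m<n. \<Sum>r<d. smult (b m r) (Q m $$ (r, k)))"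
    by (rule simple_seq_span_below[OF Q u])
  then obtain b where b: "\<And>k. k < d \<Longrightarrow> u k = (\<Sum>m<n. \<Sum>r<d. smult (b m r) (Q m $$ (r, k)))"
    by blast
  have "row_act d u V c = row_act d (\<lambda>k. \<Sum>m<n. smult 1 (\<Sum>r<d. smult (b m r) (Q m $$ (r, k)))) V c"
    by (rule row_act_cong) (simp add: b)
  also have "\<dots> = (\<Sum>m<n. smult 1 (row_act d (\<lambda>k. \<Sum>r<d. smult (b m r) (Q m $$ (r, k))) V c))"
    by (rule row_act_sum)
  also have "\<dots> = (\<Sum>m<n. \<Sum>r<d. smult (b m r) (row_act d (\<lambda>k. Q m $$ (r, k)) V c))"
    by (simp only: row_act_sum smult_1_left)
  also have "\<dots> = (\<Sum>m<n. \<Sum>r<d. smult (b m r) (\<Sum>q<N. smult (A m $$ (r, q)) (P m $$ (q, c))))"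
    using \<open>c < N\<close> by (simp add: row_act_row_eq[OF cQ V A(1) cP A(2)])
  finally have "coeff (row_act d u V c) i =
      (\<Sum>m<n. \<Sum>r<d. b m r * (\<Sum>q<N. A m $$ (r, q) * coeff (P m $$ (q, c)) i))"
    by (simp add: coeff_sum)
  also have "\<dots> = 0"
    using assms(7,8) by (intro sum.neutral ballI) (simp add: simple_seq_coeff_eq_0[OF P])
  finally show ?thesis .
qed

text \<open>For i > n the falling factorial contains the factor n - n = 0, which makes the truncated
  exponent \<open>n - i\<close> harmless.\<close>

lemma pderiv_power_monom_1:
  "(pderiv ^^ i) (monom (1::complex) n) = monom (\<Prod>j<i. of_nat n - of_nat j) (n - i)"
proof (induction i)
  case (Suc i)
  show ?case
  proof (cases "i \<le> n")
    case True
    then have "of_nat (n - i) = (of_nat n - of_nat i :: complex)" by (simp add: of_nat_diff)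
    with Suc show ?thesis by (simp add: pderiv_monom mult.commute)
  next
    case False
    then have "(\<Prod>j<i. of_nat n - of_nat j) = (0::complex)" by (intro prod_zero) auto
    with Suc show ?thesis by simp
  qed
qed simp

text \<open>From the term of order i only the coefficient of x^i in its polynomial reaches x^n. It
  is multiplied by a falling factorial of n, which is a polynomial in n.\<close>

lemma coeff_dop_act_monom_poly:
  "\<exists>g. \<forall>n. coeff (dop_act (monom 1 n) e) n = poly g (of_nat n)"
proof (intro exI allI)
  let ?g = "\<Sum>i\<le>degree e. smult (coeff (coeff e i) i) (\<Prod>j<i. [:- of_nat j, 1:])"
  fix n
  have "coeff ((pderiv ^^ i) (monom 1 n) * coeff e i) n =
      (\<Prod>j<i. of_nat n - of_nat j) * coeff (coeff e i) i" for i
  proof (cases "i \<le> n")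
    case True
    then show ?thesis by (simp add: pderiv_power_monom_1 coeff_monom_mult)
  next
    case False
    then have 0: "(\<Prod>j<i. of_nat n - of_nat j) = (0::complex)" by (intro prod_zero) auto
    show ?thesis unfolding pderiv_power_monom_1 0 by simp
  qed
  then show "coeff (dop_act (monom 1 n) e) n = poly ?g (of_nat n)"
    by (simp add: dop_act_def coeff_sum poly_sum poly_prod mult.commute)
qed

text \<open>When \<open>V\<close> does not raise degrees, this is the matrix by which it multiplies
  the coefficient of x^n in a polynomial of degree at most n from the right.\<close>

definition leading_symbol :: "dop mat \<Rightarrow> nat \<Rightarrow> complex mat" where
  "leading_symbol V n = map_mat (\<lambda>e. coeff (dop_act (monom 1 n) e) n) V"

lemma det_leading_symbol_poly:
  assumes "V \<in> carrier_mat N N"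
  shows "\<exists>g. \<forall>n. det (leading_symbol V n) = poly g (of_nat n)"
proof -
  obtain g where g: "\<And>e n. coeff (dop_act (monom 1 n) e) n = poly (g e) (of_nat n)"
    using coeff_dop_act_monom_poly by metis
  have "leading_symbol V n = map_mat (\<lambda>p. poly p (of_nat n)) (map_mat g V)" for n
    by (simp add: leading_symbol_def g mat_eq_iff)
  moreover have "det (map_mat (\<lambda>p. poly p a) M) = poly (det M) a" for M and a :: complex
    by (rule comm_ring_hom.hom_det) (unfold_locales, auto)
  ultimately show ?thesis by auto
qed

context
  fixes N :: nat and Q P :: "nat \<Rightarrow> complex poly mat" and V :: "dop mat" and A :: "nat \<Rightarrow> complex mat"
  assumes Q: "simple_seq N Q" and P: "simple_seq N P" and V: "V \<in> carrier_mat N N"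
    and A: "\<And>n. A n \<in> carrier_mat N N" "\<And>n. dop_mat_act (Q n) V = const_mat (A n) * P n"
begin

text \<open>Split off the terms in x^n. The rest \<open>w\<close> has degree below n, and so has its
  image under \<open>V\<close>.\<close>

lemma coeff_row_act_lead:
  assumes u: "\<And>k i. k < N \<Longrightarrow> n < i \<Longrightarrow> coeff (u k) i = 0" and c: "c < N"
  shows "coeff (row_act N u V c) n = (\<Sum>k<N. coeff (u k) n * leading_symbol V n $$ (k, c))"
proof -
  define w where "w k = u k - monom (coeff (u k) n) n" for k
  have "coeff (w k) i = 0" if "k < N" "n \<le> i" for k i
    using u that by (cases "i = n") (auto simp: w_def)
  then have 0: "coeff (row_act N w V c) n = 0"
    by (rule coeff_row_act_eq_0[OF Q P V A _ c order.refl])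
  have "u k = smult (coeff (u k) n) (monom 1 n) + w k" for k
    by (simp add: w_def smult_monom)
  then have "dop_act (u k) e = smult (coeff (u k) n) (dop_act (monom 1 n) e) + dop_act (w k) e" for k e
    by (metis dop_act_add_left dop_act_smult_left)
  then have "row_act N u V c =
      (\<Sum>k<N. smult (coeff (u k) n) (dop_act (monom 1 n) (V $$ (k, c)))) + row_act N w V c"
    by (simp add: row_act_def sum.distrib)
  with 0 show ?thesis
    using V c by (simp add: coeff_sum leading_symbol_def)
qed

text \<open>Comparing coefficients of x^n in Q_n V = A_n P_n gives \<open>lead\<close>. Its
  determinant at \<open>n0\<close> shows that the polynomial \<open>g\<close> is not zero, so all
  natural roots of \<open>g\<close> lie below some \<open>m\<close>, and from \<open>m\<close> on
  the symbol is invertible.\<close>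

lemma degree_preserving_if_invertible:
  assumes inv: "invertible_mat (A n0)"
  shows "degree_preserving N V"
proof -
  note cP = simple_seq_carrier[OF P] and cQ = simple_seq_carrier[OF Q]
  have S: "leading_symbol V n \<in> carrier_mat N N" for n
    using V by (simp add: leading_symbol_def)
  have lead: "coeff_mat (Q n) n * leading_symbol V n = A n * coeff_mat (P n) n" for n
  proof (rule eq_matI)
    fix r c assume "r < dim_row (A n * coeff_mat (P n) n)" "c < dim_col (A n * coeff_mat (P n) n)"
    then have rc: "r < N" "c < N" using A(1)[of n] cP[of n] by (auto simp: coeff_mat_def)
    have "(\<Sum>k<N. coeff (Q n $$ (r, k)) n * leading_symbol V n $$ (k, c)) =
        coeff (row_act N (\<lambda>k. Q n $$ (r, k)) V c) n"
      using rc by (intro coeff_row_act_lead[symmetric]) (auto simp: simple_seq_coeff_eq_0[OF Q])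
    also have "\<dots> = (\<Sum>q<N. A n $$ (r, q) * coeff (P n $$ (q, c)) n)"
      using rc by (simp add: row_act_row_eq[OF cQ V A(1) cP A(2)] coeff_sum)
    finally show "(coeff_mat (Q n) n * leading_symbol V n) $$ (r, c) = (A n * coeff_mat (P n) n) $$ (r, c)"
      using rc S[of n] A(1)[of n] cP[of n] cQ[of n]
      by (simp add: coeff_mat_def scalar_prod_def lessThan_atLeast0)
  qed (use S[of n] A(1)[of n] cP[of n] cQ[of n] in \<open>auto simp: coeff_mat_def\<close>)
  have cQP: "coeff_mat (Q n) n \<in> carrier_mat N N" "coeff_mat (P n) n \<in> carrier_mat N N" for n
    using cP cQ by (auto simp: coeff_mat_def)
  have "invertible_mat (coeff_mat (P n0) n0)" using P by (simp add: simple_seq_def)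
  then have "det (coeff_mat (P n0) n0) \<noteq> 0" "det (A n0) \<noteq> 0"
    using inv invertible_mat_iff_det[OF cQP(2)] invertible_mat_iff_det[OF A(1)] by auto
  then have nz: "det (leading_symbol V n0) \<noteq> 0"
    using arg_cong[OF lead[of n0], of det] det_mult[OF cQP(1) S] det_mult[OF A(1) cQP(2)] by auto
  obtain g where g: "\<And>n. det (leading_symbol V n) = poly g (of_nat n)"
    using det_leading_symbol_poly[OF V] by blast
  with nz have "g \<noteq> 0" by auto
  then have "finite {n. poly g (of_nat n) = 0}"
    using finite_vimageI[OF poly_roots_finite, of g of_nat] by (simp add: vimage_def inj_on_def)
  then obtain m where m: "\<And>n. poly g (of_nat n) = 0 \<Longrightarrow> n < m"
    unfolding finite_nat_set_iff_bounded by blast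
  have "has_degree (dop_mat_act f V) n" if n: "m \<le> n" and f: "f \<in> carrier_mat N N" "has_degree f n" for n f
  proof -
    have fc: "coeff (f $$ (r, k)) i = 0" if "r < N" "k < N" "n < i" for r k i
      using f that by (auto simp: has_degree_def degree_le_def intro!: coeff_eq_0)
        (metis le_less_trans)
    have fV: "dop_mat_act f V \<in> carrier_mat N N"
      using f V by (simp add: dop_mat_act_def)
    have ind: "dop_mat_act f V $$ (r, c) = row_act N (\<lambda>k. f $$ (r, k)) V c" if "r < N" "c < N" for r c
      using index_dop_mat_act[OF f(1) that(1)] that(2) V by simp
    have "coeff (dop_mat_act f V $$ (r, c)) i = 0" if "r < N" "c < N" "n < i" for r c i
    proof -
      have "coeff (row_act N (\<lambda>k. f $$ (r, k)) V c) i = 0"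
        by (rule coeff_row_act_eq_0[OF Q P V A, where n = "Suc n"]) (use that fc in auto)
      with ind that show ?thesis by simp
    qed
    then have "degree_le (dop_mat_act f V) n"
      unfolding Defs.degree_le_def using fV by (auto intro!: Polynomial.degree_le)
    moreover have "coeff_mat (dop_mat_act f V) n = coeff_mat f n * leading_symbol V n"
    proof (rule eq_matI)
      fix r c assume "r < dim_row (coeff_mat f n * leading_symbol V n)"
        "c < dim_col (coeff_mat f n * leading_symbol V n)"
      then have rc: "r < N" "c < N" using f S[of n] by (auto simp: coeff_mat_def)
      have "coeff (row_act N (\<lambda>k. f $$ (r, k)) V c) n =
          (\<Sum>k<N. coeff (f $$ (r, k)) n * leading_symbol V n $$ (k, c))"
        using rc fc by (intro coeff_row_act_lead) auto
      then show "coeff_mat (dop_mat_act f V) n $$ (r, c) = (coeff_mat f n * leading_symbol V n) $$ (r, c)"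
        using rc S[of n] f fV by (simp add: coeff_mat_def scalar_prod_def lessThan_atLeast0 ind)
    qed (use S[of n] f fV in \<open>auto simp: coeff_mat_def\<close>)
    \<comment> \<open>\<open>has_degree\<close> provides a nonzero, possibly singular, coefficient
      matrix; multiplying by an invertible symbol keeps it nonzero.\<close>
    moreover have "coeff_mat f n * leading_symbol V n \<noteq> 0\<^sub>m N N"
    proof
      assume 0: "coeff_mat f n * leading_symbol V n = 0\<^sub>m N N"
      have "invertible_mat (leading_symbol V n)"
        using m[of n] n g S by (auto simp: invertible_mat_iff_det[OF S])
      then obtain B where B: "B \<in> carrier_mat N N" "leading_symbol V n * B = 1\<^sub>m N"
        using invertible_matE[OF _ S] by metis
      have cf: "coeff_mat f n \<in> carrier_mat N N" using f by (simp add: coeff_mat_def)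
      have "coeff_mat f n = coeff_mat f n * leading_symbol V n * B"
        using assoc_mult_mat[OF cf S[of n] B(1)] B cf by simp
      also have "\<dots> = 0\<^sub>m N N" using 0 B by simp
      finally show False using f by (simp add: has_degree_def)
    qed
    ultimately show ?thesis using fV by (simp add: has_degree_def)
  qed
  then show ?thesis
    unfolding degree_preserving_def using V by (auto intro!: eventually_sequentiallyI[of m])
qed

text \<open>Take one index n at which \<open>V\<close> preserves degrees. If A_n were singular with
  left null vector \<open>v\<close>, the matrix \<open>f\<close> whose rows all equal v Q_n would
  have degree n but be annihilated by \<open>V\<close>.\<close>

lemma invertible_if_degree_preserving:
  assumes "degree_preserving N V"
  shows "\<exists>n. invertible_mat (A n)"
proof -
  note cP = simple_seq_carrier[OF P] and cQ = simple_seq_carrier[OF Q]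
  obtain n where n: "\<And>f. f \<in> carrier_mat N N \<Longrightarrow> has_degree f n \<Longrightarrow> has_degree (dop_mat_act f V) n"
    using assms unfolding degree_preserving_def eventually_sequentially by blast
  have "det (A n) \<noteq> 0"
  proof
    assume "det (A n) = 0"
    then have "det (transpose_mat (A n)) = 0" using det_transpose[OF A(1)] by simp
    then obtain v where v: "v \<in> carrier_vec N" "v \<noteq> 0\<^sub>v N" "transpose_mat (A n) *\<^sub>v v = 0\<^sub>v N"
      using det_0_iff_vec_prod_zero[of "transpose_mat (A n)" N] A(1)[of n] by auto
    have vA: "(\<Sum>t<N. v $ t * A n $$ (t, q)) = 0" if "q < N" for q
    proof -
      have "(transpose_mat (A n) *\<^sub>v v) $ q = (\<Sum>t<N. v $ t * A n $$ (t, q))"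
        using v(1) A(1)[of n] that by (simp add: scalar_prod_def lessThan_atLeast0 mult.commute)
      with v(3) that show ?thesis by simp
    qed
    define f where "f = Matrix.mat N N (\<lambda>(_, k). \<Sum>t<N. smult (v $ t) (Q n $$ (t, k)))"
    have f: "f \<in> carrier_mat N N" by (simp add: f_def)
    have "coeff (f $$ (r, k)) i = 0" if "r < N" "k < N" "n < i" for r k i
      using that by (simp add: f_def coeff_sum simple_seq_coeff_eq_0[OF Q])
    then have "degree_le f n"
      unfolding Defs.degree_le_def using f by (auto intro!: Polynomial.degree_le)
    moreover have "coeff_mat f n \<noteq> 0\<^sub>m N N"
    proof
      assume 0: "coeff_mat f n = 0\<^sub>m N N"
      have "v $ s = 0" if "s < N" for s
      proof (rule simple_seq_independent[OF Q _ that])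
        fix k assume "k < N"
        then show "(\<Sum>t<N. v $ t * coeff (Q n $$ (t, k)) n) = 0"
          using arg_cong[OF 0, of "\<lambda>M. M $$ (s, k)"] that
          by (simp add: coeff_mat_def f_def coeff_sum)
      qed
      with v(1,2) show False by auto
    qed
    ultimately have "has_degree (dop_mat_act f V) n"
      using n f by (simp add: has_degree_def)
    moreover have "dop_mat_act f V = 0\<^sub>m N N"
    proof (rule eq_matI)
      fix r c assume "r < dim_row (0\<^sub>m N N)" "c < dim_col (0\<^sub>m N N)"
      then have rc: "r < N" "c < N" by auto
      then have "dop_mat_act f V $$ (r, c) = row_act N (\<lambda>k. f $$ (r, k)) V c"
        using index_dop_mat_act[OF f] V by simp
      also have "\<dots> = row_act N (\<lambda>k. \<Sum>t<N. smult (v $ t) (Q n $$ (t, k))) V c"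
        using rc by (intro row_act_cong) (simp add: f_def)
      also have "\<dots> = (\<Sum>t<N. smult (v $ t) (\<Sum>q<N. smult (A n $$ (t, q)) (P n $$ (q, c))))"
        unfolding row_act_sum using rc by (simp add: row_act_row_eq[OF cQ V A(1) cP A(2)])
      also have "\<dots> = (\<Sum>t<N. \<Sum>q<N. smult (v $ t * A n $$ (t, q)) (P n $$ (q, c)))"
        by (simp add: smult_sum2)
      also have "\<dots> = (\<Sum>q<N. smult (\<Sum>t<N. v $ t * A n $$ (t, q)) (P n $$ (q, c)))"
        by (subst sum.swap) (simp add: smult_sum)
      also have "\<dots> = 0" by (simp add: vA)
      finally show "dop_mat_act f V $$ (r, c) = 0\<^sub>m N N $$ (r, c)" using rc by simp
    qed (use f V in \<open>auto simp: dop_mat_act_def\<close>)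
    ultimately show False
      by (auto simp: has_degree_def coeff_mat_def mat_eq_iff)
  qed
  then show ?thesis using invertible_mat_iff_det[OF A(1)] by blast
qed

end

subsection \<open>Direct sums\<close>

text \<open>One recursion step of \<open>diag_block_mat\<close>, so that statements on two blocks
  extend to any number by induction.\<close>

abbreviation diag2 :: "'a::zero mat \<Rightarrow> 'a mat \<Rightarrow> 'a mat" where
  "diag2 A B \<equiv> four_block_mat A (0\<^sub>m (dim_row A) (dim_col B)) (0\<^sub>m (dim_row B) (dim_col A)) B"

lemma diag_block_mat_Cons: "diag_block_mat (A # As) = diag2 A (diag_block_mat As)"
  by (simp add: Let_def)

lemma positive_definite_diag2:
  assumes A: "positive_definite m A" and B: "positive_definite n B"
  shows "positive_definite (m + n) (diag2 A B)"
proof -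
  have cA: "A \<in> carrier_mat m m" and cB: "B \<in> carrier_mat n n"
    using A B by (auto simp: positive_definite_def)
  have hA: "cnj (A $$ (j, i)) = A $$ (i, j)" if "i < m" "j < m" for i j
    using A cA that index_mat_adjoint[of i A j] by (simp add: positive_definite_def)
  have hB: "cnj (B $$ (j, i)) = B $$ (i, j)" if "i < n" "j < n" for i j
    using B cB that index_mat_adjoint[of i B j] by (simp add: positive_definite_def)
  have "mat_adjoint (diag2 A B) = diag2 A B"
    using cA cB by (intro eq_matI) (auto simp: hA hB)
  moreover have "0 < Re ((diag2 A B *\<^sub>v v) \<bullet>c v)" if v: "v \<in> carrier_vec (m + n)" "v \<noteq> 0\<^sub>v (m + n)" for v
  proof -
    define a where "a = vec_first v m"
    define b where "b = vec_last v n"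
    have ab: "a \<in> carrier_vec m" "b \<in> carrier_vec n" "v = a @\<^sub>v b"
      using v(1) by (simp_all add: a_def b_def)
    have "diag2 A B *\<^sub>v v = (A *\<^sub>v a) @\<^sub>v (B *\<^sub>v b)"
      unfolding ab(3) using cA cB ab
      by (subst four_block_mat_mult_vec[of _ m m _ n _ n]) auto
    moreover have "conjugate v = conjugate a @\<^sub>v conjugate b"
      using ab by (intro eq_vecI) auto
    ultimately have "(diag2 A B *\<^sub>v v) \<bullet>c v = (A *\<^sub>v a) \<bullet>c a + (B *\<^sub>v b) \<bullet>c b"
      using cA cB ab by (simp add: scalar_prod_append[of _ m _ n])
    moreover have "a \<noteq> 0\<^sub>v m \<or> b \<noteq> 0\<^sub>v n"
      using v(2) ab(3) by auto
    moreover have "0 < Re ((A *\<^sub>v a) \<bullet>c a)" if "a \<noteq> 0\<^sub>v m"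
      using A ab that by (simp add: positive_definite_def)
    moreover have "0 < Re ((B *\<^sub>v b) \<bullet>c b)" if "b \<noteq> 0\<^sub>v n"
      using B ab that by (simp add: positive_definite_def)
    moreover have "(A *\<^sub>v a) \<bullet>c a = 0" if "a = 0\<^sub>v m"
      using that cA by simp
    moreover have "(B *\<^sub>v b) \<bullet>c b = 0" if "b = 0\<^sub>v n"
      using that cB by simp
    ultimately show ?thesis
      by (cases "a = 0\<^sub>v m"; cases "b = 0\<^sub>v n") (simp_all add: add_pos_pos)
  qed
  ultimately show ?thesis
    using cA cB by (simp add: positive_definite_def)
qed

lemma positive_definite_empty: "positive_definite 0 (0\<^sub>m 0 0)"
  unfolding positive_definite_def by (auto simp: mat_eq_iff vec_eq_iff)

lemma weighted_interval_empty: "x0 < x1 \<Longrightarrow> weighted_interval x0 x1 0 (\<lambda>x. 0\<^sub>m 0 0)"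
  by (simp add: weighted_interval_def positive_definite_empty)

lemma weighted_interval_diag2:
  assumes "weighted_interval x0 x1 m A" and "weighted_interval x0 x1 n B"
  shows "weighted_interval x0 x1 (m + n) (\<lambda>x. diag2 (A x) (B x))"
proof -
  interpret A: weighted_interval x0 x1 m A by fact
  interpret B: weighted_interval x0 x1 n B by fact
  show ?thesis
  proof
    show "x0 < x1" by (rule A.interval)
    show "diag2 (A x) (B x) \<in> carrier_mat (m + n) (m + n)" if "x \<in> einterval x0 x1" for x
      using A.W_carrier[OF that] B.W_carrier[OF that] by simp
    show "AE x in lborel. x \<in> einterval x0 x1 \<longrightarrow> positive_definite (m + n) (diag2 (A x) (B x))"
      using A.AE_positive_definite B.AE_positive_definite
      by eventually_elim (blast intro: positive_definite_diag2)
    fix i j k assume ij: "i < m + n" "j < m + n"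
    \<comment> \<open>The sizes of \<open>A x\<close> and \<open>B x\<close> are known only for x in
      the interval. The entry is therefore first written with the fixed m and identified with that
      of \<open>diag2\<close> on the interval alone.\<close>
    have "set_integrable lborel (einterval x0 x1) (\<lambda>x. of_real (x ^ k) *
      (if i < m then if j < m then A x $$ (i, j) else 0
       else if j < m then 0 else B x $$ (i - m, j - m)))"
      using ij A.integrable_moment[of i j k] B.integrable_moment[of "i - m" "j - m" k]
      by (cases "i < m"; cases "j < m") (auto simp: set_integrable_def)
    also have "?this \<longleftrightarrow> set_integrable lborel (einterval x0 x1)
      (\<lambda>x. of_real (x ^ k) * diag2 (A x) (B x) $$ (i, j))"
    proof (intro set_integrable_cong refl)
      fix x assume x: "x \<in> einterval x0 x1"
      show "of_real (x ^ k) * (if i < m then if j < m then A x $$ (i, j) else 0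
          else if j < m then 0 else B x $$ (i - m, j - m)) =
        of_real (x ^ k) * diag2 (A x) (B x) $$ (i, j)"
        using ij carrier_matD[OF A.W_carrier[OF x]] carrier_matD[OF B.W_carrier[OF x]] by auto
    qed
    finally show "set_integrable lborel (einterval x0 x1)
      (\<lambda>x. of_real (x ^ k) * diag2 (A x) (B x) $$ (i, j))" .
  qed
qed

lemma row_form_diag2:
  assumes "weighted_interval x0 x1 m A" and "weighted_interval x0 x1 n B"
  shows "row_form x0 x1 (m + n) (\<lambda>x. diag2 (A x) (B x)) u v =
    row_form x0 x1 m A u v + row_form x0 x1 n B (\<lambda>k. u (m + k)) (\<lambda>k. v (m + k))"
proof -
  interpret A: weighted_interval x0 x1 m A by fact
  interpret B: weighted_interval x0 x1 n B by fact
  show ?thesis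
    unfolding row_form_def
  proof (subst set_integral_add(2)[OF A.integrable_form B.integrable_form, symmetric],
      intro set_lebesgue_integral_cong allI impI)
    fix x assume "x \<in> einterval x0 x1"
    note [simp] = carrier_matD[OF A.W_carrier[OF this]] carrier_matD[OF B.W_carrier[OF this]]
    show "(\<Sum>k<m + n. \<Sum>l<m + n. poly (u k) (of_real x) * diag2 (A x) (B x) $$ (k, l) *
        cnj (poly (v l) (of_real x))) =
      (\<Sum>k<m. \<Sum>l<m. poly (u k) (of_real x) * A x $$ (k, l) * cnj (poly (v l) (of_real x))) +
      (\<Sum>k<n. \<Sum>l<n. poly (u (m + k)) (of_real x) * B x $$ (k, l) *
        cnj (poly (v (m + l)) (of_real x)))"
      by (simp add: sum_lessThan_add)
  qed simp
qed

lemma simple_seq_diag2: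
  assumes P: "simple_seq m P" and Q: "simple_seq n Q"
  shows "simple_seq (m + n) (\<lambda>k. diag2 (P k) (Q k))"
  unfolding simple_seq_def
proof (intro allI conjI)
  fix k
  note cP = simple_seq_carrier[OF P, of k] and cQ = simple_seq_carrier[OF Q, of k]
  show "diag2 (P k) (Q k) \<in> carrier_mat (m + n) (m + n)"
    using cP cQ by simp
  show "degree_le (diag2 (P k) (Q k)) k"
    using P Q cP cQ by (auto simp: simple_seq_def Defs.degree_le_def)
  have c: "coeff_mat (P k) k \<in> carrier_mat m m" "coeff_mat (Q k) k \<in> carrier_mat n n"
    using cP cQ by (auto simp: coeff_mat_def)
  have "coeff_mat (diag2 (P k) (Q k)) k = diag2 (coeff_mat (P k) k) (coeff_mat (Q k) k)"
    using cP cQ by (intro eq_matI) (auto simp: coeff_mat_def)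
  also have "det \<dots> = det (coeff_mat (P k) k) * det (coeff_mat (Q k) k)"
    using c by (intro det_four_block_mat_lower_left_zero[where n = m and m = n]) auto
  also have "\<dots> \<noteq> 0"
    using P Q invertible_mat_iff_det[OF c(1)] invertible_mat_iff_det[OF c(2)]
    by (simp add: simple_seq_def)
  finally show "invertible_mat (coeff_mat (diag2 (P k) (Q k)) k)"
    using cP cQ by (subst invertible_mat_iff_det[of _ "m + n"]) (auto simp: coeff_mat_def)
qed

text \<open>Orthogonality expressed row by row, the form in which it splits along
  \<open>row_form_diag2\<close>.\<close>

lemma mvop_iff:
  assumes "weighted_interval x0 x1 N W"
  shows "mvop x0 x1 N W P \<longleftrightarrow> simple_seq N P \<and> (\<forall>n m. n \<noteq> m \<longrightarrow> (\<forall>r<N. \<forall>c<N.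
    row_form x0 x1 N W (\<lambda>k. P n $$ (r, k)) (\<lambda>k. P m $$ (c, k)) = 0))"
proof -
  interpret weighted_interval x0 x1 N W by fact
  show ?thesis
    unfolding mvop_def simple_seq_def[symmetric]
  proof (intro conj_cong refl all_cong1 imp_cong)
    assume P: "simple_seq N P"
    fix n m
    have "weight_inner x0 x1 N W (P n) (P m) = 0\<^sub>m N N \<longleftrightarrow>
        (\<forall>r<N. \<forall>c<N. weight_inner x0 x1 N W (P n) (P m) $$ (r, c) = 0)"
      by (auto simp: mat_eq_iff weight_inner_def mat_integral_def)
    then show "weight_inner x0 x1 N W (P n) (P m) = 0\<^sub>m N N \<longleftrightarrow> (\<forall>r<N. \<forall>c<N.
        form (\<lambda>k. P n $$ (r, k)) (\<lambda>k. P m $$ (c, k)) = 0)"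
      using simple_seq_carrier[OF P] by (simp add: index_weight_inner)
  qed
qed

lemma mvop_diag2:
  assumes A: "weighted_interval x0 x1 m A" and B: "weighted_interval x0 x1 n B"
    and P: "mvop x0 x1 m A P" and Q: "mvop x0 x1 n B Q"
  shows "mvop x0 x1 (m + n) (\<lambda>x. diag2 (A x) (B x)) (\<lambda>k. diag2 (P k) (Q k))"
proof -
  interpret A: weighted_interval x0 x1 m A by fact
  interpret B: weighted_interval x0 x1 n B by fact
  have sP: "simple_seq m P" and sQ: "simple_seq n Q"
    using P Q by (auto simp: simple_seq_if_mvop)
  note [simp] = carrier_matD[OF simple_seq_carrier[OF sP]] carrier_matD[OF simple_seq_carrier[OF sQ]]
  have orth: "r < m \<Longrightarrow> c < m \<Longrightarrow> A.form (\<lambda>k. P i $$ (r, k)) (\<lambda>k. P j $$ (c, k)) = 0"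
    "r < n \<Longrightarrow> c < n \<Longrightarrow> B.form (\<lambda>k. Q i $$ (r, k)) (\<lambda>k. Q j $$ (c, k)) = 0"
    if "i \<noteq> j" for i j r c
    using P Q that unfolding mvop_iff[OF A] mvop_iff[OF B] by auto
  \<comment> \<open>Each row of the direct sum is supported in a single block. Only a pair of rows
    from the first block contributes to the form of \<open>A\<close>; \<open>rowQ\<close> is the
    counterpart for \<open>B\<close>.\<close>
  have rowP: "A.form (\<lambda>k. diag2 (P i) (Q i) $$ (r, k)) (\<lambda>k. diag2 (P j) (Q j) $$ (c, k)) =
      (if r < m \<and> c < m then A.form (\<lambda>k. P i $$ (r, k)) (\<lambda>k. P j $$ (c, k)) else 0)"
    if "r < m + n" "c < m + n" for i j r c
  proof -
    have "A.form (\<lambda>k. diag2 (P i) (Q i) $$ (r, k)) (\<lambda>k. diag2 (P j) (Q j) $$ (c, k)) =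
        A.form (\<lambda>k. if r < m then P i $$ (r, k) else 0) (\<lambda>k. if c < m then P j $$ (c, k) else 0)"
      using that by (intro A.form_cong) auto
    then show ?thesis by auto
  qed
  have rowQ: "B.form (\<lambda>k. diag2 (P i) (Q i) $$ (r, m + k)) (\<lambda>k. diag2 (P j) (Q j) $$ (c, m + k)) =
      (if \<not> r < m \<and> \<not> c < m then B.form (\<lambda>k. Q i $$ (r - m, k)) (\<lambda>k. Q j $$ (c - m, k)) else 0)"
    if "r < m + n" "c < m + n" for i j r c
  proof -
    have "B.form (\<lambda>k. diag2 (P i) (Q i) $$ (r, m + k)) (\<lambda>k. diag2 (P j) (Q j) $$ (c, m + k)) =
        B.form (\<lambda>k. if r < m then 0 else Q i $$ (r - m, k)) (\<lambda>k. if c < m then 0 else Q j $$ (c - m, k))"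
      using that by (intro B.form_cong) auto
    then show ?thesis by auto
  qed
  show ?thesis
    unfolding mvop_iff[OF weighted_interval_diag2[OF A B]]
  proof (intro conjI allI impI)
    show "simple_seq (m + n) (\<lambda>k. diag2 (P k) (Q k))" by (rule simple_seq_diag2[OF sP sQ])
    fix i j r c :: nat assume ij: "i \<noteq> j" and rc: "r < m + n" "c < m + n"
    show "row_form x0 x1 (m + n) (\<lambda>x. diag2 (A x) (B x))
        (\<lambda>k. diag2 (P i) (Q i) $$ (r, k)) (\<lambda>k. diag2 (P j) (Q j) $$ (c, k)) = 0"
      unfolding row_form_diag2[OF A B] rowP[OF rc] rowQ[OF rc] using orth[OF ij] rc by auto
  qed
qed

lemma weight_direct_sum_Cons:
  "weight_direct_sum (W # Ws) = (\<lambda>x. diag2 (W x) (weight_direct_sum Ws x))"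
  by (simp add: weight_direct_sum_def Let_def)

lemma direct_sum:
  assumes "x0 < x1" and "\<And>j. j \<in> set js \<Longrightarrow> weighted_interval x0 x1 (d j) (w j)"
    and "\<And>j. j \<in> set js \<Longrightarrow> mvop x0 x1 (d j) (w j) (p j)"
  shows weighted_interval_direct_sum:
      "weighted_interval x0 x1 (sum_list (map d js)) (weight_direct_sum (map w js))"
    and mvop_direct_sum: "mvop x0 x1 (sum_list (map d js)) (weight_direct_sum (map w js))
      (\<lambda>n. diag_block_mat (map (\<lambda>j. p j n) js))"
proof -
  \<comment> \<open>Both claims go through one induction, since adding a block to the orthogonal
    sequence uses the weight properties of the tail.\<close>
  have "weighted_interval x0 x1 (sum_list (map d js)) (weight_direct_sum (map w js)) \<and>
    mvop x0 x1 (sum_list (map d js)) (weight_direct_sum (map w js))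
      (\<lambda>n. diag_block_mat (map (\<lambda>j. p j n) js))"
    using assms(2,3)
  proof (induction js)
    case Nil
    have "weighted_interval x0 x1 0 (\<lambda>x. 0\<^sub>m 0 0)" using assms(1) by (rule weighted_interval_empty)
    \<comment> \<open>For size 0 everything is vacuous except invertibility of the leading
      coefficients, which holds because the empty matrix has determinant 1.\<close>
    then show ?case
      by (simp add: weight_direct_sum_def mvop_iff simple_seq_def degree_le_def coeff_mat_def
          invertible_mat_iff_det[of _ 0])
  next
    case (Cons j js)
    let ?Z = "weight_direct_sum (map w js)" and ?Q = "\<lambda>n. diag_block_mat (map (\<lambda>j. p j n) js)"
    have IH: "weighted_interval x0 x1 (sum_list (map d js)) ?Z" "mvop x0 x1 (sum_list (map d js)) ?Z ?Q"
      using Cons.IH Cons.prems by auto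
    have j: "weighted_interval x0 x1 (d j) (w j)" "mvop x0 x1 (d j) (w j) (p j)"
      using Cons.prems by auto
    show ?case
      unfolding list.map sum_list.Cons weight_direct_sum_Cons diag_block_mat_Cons
      using weighted_interval_diag2[OF j(1) IH(1)] mvop_diag2[OF j(1) IH(1) j(2) IH(2)]
      by (rule conjI)
  qed
  then show "weighted_interval x0 x1 (sum_list (map d js)) (weight_direct_sum (map w js))"
    and "mvop x0 x1 (sum_list (map d js)) (weight_direct_sum (map w js))
      (\<lambda>n. diag_block_mat (map (\<lambda>j. p j n) js))"
    by auto
qed

section \<open>Vertical stacking of row blocks\<close>

lemma dim_append_rows [simp]:
  "dim_row (A @\<^sub>r B) = dim_row A + dim_row B" "dim_col (A @\<^sub>r B) = dim_col A"
  by (simp_all add: append_rows_def)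

lemma index_append_rows:
  "A \<in> carrier_mat a n \<Longrightarrow> B \<in> carrier_mat b n \<Longrightarrow> i < a + b \<Longrightarrow> j < n \<Longrightarrow>
    (A @\<^sub>r B) $$ (i, j) = (if i < a then A $$ (i, j) else B $$ (i - a, j))"
  by (auto simp: append_rows_def)

lemma append_rows_split:
  assumes "A \<in> carrier_mat (a + b) n"
  obtains A1 A2 where "A1 \<in> carrier_mat a n" "A2 \<in> carrier_mat b n" "A = A1 @\<^sub>r A2"
proof
  define A1 where "A1 = Matrix.mat a n (\<lambda>(i, j). A $$ (i, j))"
  define A2 where "A2 = Matrix.mat b n (\<lambda>(i, j). A $$ (a + i, j))"
  show c: "A1 \<in> carrier_mat a n" "A2 \<in> carrier_mat b n" by (auto simp: A1_def A2_def)
  have "(A1 @\<^sub>r A2) $$ (i, j) = A $$ (i, j)" if "i < a + b" "j < n" for i j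
    using that by (subst index_append_rows[OF c that]) (auto simp: A1_def A2_def)
  then show "A = A1 @\<^sub>r A2"
    using assms carrier_matD[OF carrier_append_rows[OF c]] by (intro eq_matI) auto
qed

lemma append_rows_eq_iff:
  assumes "A \<in> carrier_mat a n" "B \<in> carrier_mat b n" "A' \<in> carrier_mat a n" "B' \<in> carrier_mat b n"
  shows "A @\<^sub>r B = A' @\<^sub>r B' \<longleftrightarrow> A = A' \<and> B = B'"
proof
  assume eq: "A @\<^sub>r B = A' @\<^sub>r B'"
  have "A $$ (i, j) = A' $$ (i, j)" if "i < a" "j < n" for i j
    using arg_cong[OF eq, of "\<lambda>M. M $$ (i, j)"] assms that by (simp add: index_append_rows)
  moreover have "B $$ (i, j) = B' $$ (i, j)" if "i < b" "j < n" for i j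
    using arg_cong[OF eq, of "\<lambda>M. M $$ (a + i, j)"] assms that by (simp add: index_append_rows)
  ultimately show "A = A' \<and> B = B'"
    using assms by (auto intro!: eq_matI)
qed simp

lemma stack_rows_Nil: "stack_rows n [] = 0\<^sub>m 0 n"
  by (auto simp: stack_rows_def mat_eq_iff)

lemma stack_rows_carrier:
  "stack_rows n As \<in> carrier_mat (sum_list (map dim_row As)) n"
proof -
  have "length (concat (map rows As)) = sum_list (map dim_row As)"
    by (simp add: length_concat o_def)
  then show ?thesis
    unfolding stack_rows_def using mat_of_rows_carrier(1) by metis
qed

lemma stack_rows_Cons:
  assumes "A \<in> carrier_mat a n"
  shows "stack_rows n (A # As) = A @\<^sub>r stack_rows n As"
proof (rule eq_matI)
  let ?b = "sum_list (map dim_row As)"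
  note c = assms stack_rows_carrier[of n As]
  fix i j assume "i < dim_row (A @\<^sub>r stack_rows n As)" "j < dim_col (A @\<^sub>r stack_rows n As)"
  then have ij: "i < a + ?b" "j < n"
    using carrier_append_rows[OF c] by auto
  then show "stack_rows n (A # As) $$ (i, j) = (A @\<^sub>r stack_rows n As) $$ (i, j)"
    using assms
    by (subst index_append_rows[OF c])
       (auto simp: stack_rows_def mat_of_rows_def nth_append length_concat o_def)
qed (use stack_rows_carrier[of n "A # As"] carrier_append_rows[OF assms stack_rows_carrier[of n As]]
    assms in auto)

lemma dop_mat_act_diag2:
  assumes "P \<in> carrier_mat a a" "Q \<in> carrier_mat b b" "D \<in> carrier_mat a n" "E \<in> carrier_mat b n"
  shows "dop_mat_act (diag2 P Q) (D @\<^sub>r E) = dop_mat_act P D @\<^sub>r dop_mat_act Q E"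
proof -
  have c: "dop_mat_act P D \<in> carrier_mat a n" "dop_mat_act Q E \<in> carrier_mat b n"
    using assms by (auto simp: dop_mat_act_def)
  note cDE = carrier_append_rows[OF assms(3,4)]
  show ?thesis
  proof (rule eq_matI)
    fix i j assume "i < dim_row (dop_mat_act P D @\<^sub>r dop_mat_act Q E)"
      "j < dim_col (dop_mat_act P D @\<^sub>r dop_mat_act Q E)"
    then have ij: "i < a + b" "j < n"
      using carrier_append_rows[OF c] by auto
    have "dop_mat_act (diag2 P Q) (D @\<^sub>r E) $$ (i, j) =
        (\<Sum>k<a + b. dop_act (diag2 P Q $$ (i, k)) ((D @\<^sub>r E) $$ (k, j)))"
      using ij assms carrier_matD[OF cDE] by (simp add: dop_mat_act_def del: index_mat_four_block(1))
    also have "\<dots> = (dop_mat_act P D @\<^sub>r dop_mat_act Q E) $$ (i, j)"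
      using ij assms
      by (simp add: sum_lessThan_add index_append_rows[OF assms(3,4)] index_append_rows[OF c])
         (simp add: dop_mat_act_def)
    finally show "dop_mat_act (diag2 P Q) (D @\<^sub>r E) $$ (i, j) =
        (dop_mat_act P D @\<^sub>r dop_mat_act Q E) $$ (i, j)" .
  qed (use assms in \<open>auto simp: dop_mat_act_def\<close>)
qed

lemma const_mat_append_rows_mult:
  assumes "A \<in> carrier_mat a m" "B \<in> carrier_mat b m" "P \<in> carrier_mat m n"
  shows "const_mat (A @\<^sub>r B) * P = (const_mat A * P) @\<^sub>r (const_mat B * P)"
proof -
  have c: "const_mat A * P \<in> carrier_mat a n" "const_mat B * P \<in> carrier_mat b n"
    using assms by (auto simp: const_mat_def)
  note cAB = carrier_append_rows[OF assms(1,2)]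
  show ?thesis
  proof (rule eq_matI)
    fix i j assume "i < dim_row ((const_mat A * P) @\<^sub>r (const_mat B * P))"
      "j < dim_col ((const_mat A * P) @\<^sub>r (const_mat B * P))"
    then have ij: "i < a + b" "j < n"
      using carrier_append_rows[OF c] by auto
    then show "(const_mat (A @\<^sub>r B) * P) $$ (i, j) = ((const_mat A * P) @\<^sub>r (const_mat B * P)) $$ (i, j)"
      using assms carrier_matD[OF cAB]
      by (simp add: index_append_rows[OF c])
         (auto simp: const_mat_def scalar_prod_def index_append_rows[OF assms(1,2)])
  qed (use assms in \<open>auto simp: const_mat_def\<close>)
qed

section \<open>Composition of intertwining relations and the criterion for two weights of equal
  size\<close>

lemma const_mat_carrier: "A \<in> carrier_mat m n \<Longrightarrow> const_mat A \<in> carrier_mat m n"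
  by (simp add: const_mat_def)

lemma const_mat_mult:
  assumes "A \<in> carrier_mat l m" "B \<in> carrier_mat m n"
  shows "const_mat (A * B) = const_mat A * const_mat B"
proof -
  interpret h: semiring_hom "\<lambda>c::complex. [:c:]"
    by unfold_locales (simp_all add: one_pCons)
  show ?thesis
    unfolding const_mat_def using assms by (rule h.mat_hom_mult)
qed

text \<open>Constants multiply from the left and operators act from the right, so the two commute.
  This lets the relations for \<open>V\<close> and \<open>E\<close> be chained.\<close>

lemma dop_mat_act_const_mat_mult:
  assumes "A \<in> carrier_mat l m" "P \<in> carrier_mat m n" "D \<in> carrier_mat n k"
  shows "dop_mat_act (const_mat A * P) D = const_mat A * dop_mat_act P D"
proof (rule eq_matI)
  fix i j assume "i < dim_row (const_mat A * dop_mat_act P D)" "j < dim_col (const_mat A * dop_mat_act P D)"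
  then have ij: "i < l" "j < k" using assms by (auto simp: const_mat_def dop_mat_act_def)
  have "row_act n (\<lambda>q. (const_mat A * P) $$ (i, q)) D j =
      row_act n (\<lambda>q. \<Sum>t<m. smult (A $$ (i, t)) (P $$ (t, q))) D j"
    using ij assms by (intro row_act_cong) (simp add: const_mat_def scalar_prod_def lessThan_atLeast0)
  also have "\<dots> = (\<Sum>t<m. smult (A $$ (i, t)) (row_act n (\<lambda>q. P $$ (t, q)) D j))"
    by (rule row_act_sum)
  finally show "dop_mat_act (const_mat A * P) D $$ (i, j) = (const_mat A * dop_mat_act P D) $$ (i, j)"
    using ij assms
    by (simp add: dop_mat_act_def row_act_def const_mat_def scalar_prod_def lessThan_atLeast0)
qed (use assms in \<open>auto simp: const_mat_def dop_mat_act_def\<close>)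

text \<open>Given a Darboux transformation, its first factor is degree-preserving, so some A_n is
  invertible. Conversely the adjoint \<open>E\<close> of \<open>V\<close> is the second factor: B_n
  is invertible wherever A_n is, so both factors preserve degrees, and Q_n (V E) = A_n B_n Q_n puts
  the product into the algebra of \<open>Z\<close>.\<close>

theorem darboux_transformation_iff:
  assumes Z: "weighted_interval x0 x1 N Z" and W: "weighted_interval x0 x1 N W"
    and Q: "mvop x0 x1 N Z Q" and P: "mvop x0 x1 N W P"
  shows "darboux_transformation x0 x1 N Z Q P \<longleftrightarrow>
    (\<exists>V\<in>carrier_mat N N. \<exists>A. (\<forall>n. A n \<in> carrier_mat N N \<and> dop_mat_act (Q n) V = const_mat (A n) * P n) \<and>
      (\<exists>n. invertible_mat (A n)))"
proof
  note sQ = simple_seq_if_mvop[OF Q] and sP = simple_seq_if_mvop[OF P]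
  assume "darboux_transformation x0 x1 N Z Q P"
  then obtain V where V: "degree_preserving N V"
    "\<forall>n. \<exists>A\<in>carrier_mat N N. dop_mat_act (Q n) V = const_mat A * P n"
    unfolding darboux_transformation_def by blast
  then obtain A where A: "\<And>n. A n \<in> carrier_mat N N" "\<And>n. dop_mat_act (Q n) V = const_mat (A n) * P n"
    by metis
  have cV: "V \<in> carrier_mat N N" using V(1) by (simp add: degree_preserving_def)
  have "\<exists>n. invertible_mat (A n)"
    by (rule invertible_if_degree_preserving[OF sQ sP cV A V(1)])
  with A cV show "\<exists>V\<in>carrier_mat N N. \<exists>A. (\<forall>n. A n \<in> carrier_mat N N \<and>
      dop_mat_act (Q n) V = const_mat (A n) * P n) \<and> (\<exists>n. invertible_mat (A n))"
    by blast
next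
  interpret two_weighted_intervals x0 x1 N N Z W
    using Z W by (rule two_weighted_intervals.intro)
  note sQ = simple_seq_if_mvop[OF Q] and sP = simple_seq_if_mvop[OF P]
  note cQ = simple_seq_carrier[OF sQ] and cP = simple_seq_carrier[OF sP]
  assume "\<exists>V\<in>carrier_mat N N. \<exists>A. (\<forall>n. A n \<in> carrier_mat N N \<and>
      dop_mat_act (Q n) V = const_mat (A n) * P n) \<and> (\<exists>n. invertible_mat (A n))"
  then obtain V A n0 where V: "V \<in> carrier_mat N N"
    and A: "\<And>n. A n \<in> carrier_mat N N" "\<And>n. dop_mat_act (Q n) V = const_mat (A n) * P n"
    and inv: "invertible_mat (A n0)"
    by blast
  obtain E B where E: "E \<in> carrier_mat N N" and B: "\<And>n. B n \<in> carrier_mat N N"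
    "\<And>n. dop_mat_act (P n) E = const_mat (B n) * Q n"
    and invB: "\<And>n. invertible_mat (A n) \<Longrightarrow> invertible_mat (B n)"
    using adjoint_exists[OF P Q V A] by blast
  have dV: "degree_preserving N V" by (rule degree_preserving_if_invertible[OF sQ sP V A inv])
  have dE: "degree_preserving N E"
    by (rule degree_preserving_if_invertible[OF sP sQ E B invB[OF inv]])
  have "dop_mat_act (Q n) (dop_mat_mult V E) = const_mat (A n * B n) * Q n" for n
  proof -
    have "dop_mat_act (Q n) (dop_mat_mult V E) = dop_mat_act (const_mat (A n) * P n) E"
      by (simp add: dop_mat_act_mult[OF cQ V E] A(2))
    also have "\<dots> = const_mat (A n) * (const_mat (B n) * Q n)"
      by (simp add: dop_mat_act_const_mat_mult[OF A(1) cP E] B(2))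
    also have "\<dots> = const_mat (A n * B n) * Q n"
      using const_mat_mult[OF A(1) B(1), of n n]
        assoc_mult_mat[OF const_mat_carrier[OF A(1)] const_mat_carrier[OF B(1)] cQ, of n n n] by simp
    finally show ?thesis .
  qed
  moreover have "A n * B n \<in> carrier_mat N N" for n
    using A(1) B(1) by (rule mult_carrier_mat)
  moreover have "dop_mat_mult V E \<in> carrier_mat N N"
    using V E by (simp add: dop_mat_mult_def)
  ultimately have "dop_mat_mult V E \<in> weight_algebra x0 x1 N Z"
    unfolding weight_algebra_def using Q by blast
  then show "darboux_transformation x0 x1 N Z Q P"
    unfolding darboux_transformation_def using dV dE A by blast
qed

section \<open>One operator on the direct sum versus its row blocks\<close>

lemma diag_block_mat_carrier:
  assumes "\<And>j. j \<in> set js \<Longrightarrow> p j \<in> carrier_mat (d j) (d j)"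
  shows "diag_block_mat (map p js) \<in> carrier_mat (sum_list (map d js)) (sum_list (map d js))"
  using assms by (induction js) (auto simp: Let_def)

lemma stack_blocks:
  assumes P: "\<And>n. P n \<in> carrier_mat N N"
    and p: "\<And>j n. j \<in> set js \<Longrightarrow> p j n \<in> carrier_mat (d j) (d j)"
    and D: "\<And>j. j \<in> set js \<Longrightarrow> D j \<in> carrier_mat (d j) N"
    and L: "\<And>j n. j \<in> set js \<Longrightarrow> L j n \<in> carrier_mat (d j) N"
      "\<And>j n. j \<in> set js \<Longrightarrow> const_mat (L j n) * P n = dop_mat_act (p j n) (D j)"
  shows "\<exists>V\<in>carrier_mat (sum_list (map d js)) N. \<forall>n.
    stack_rows N (map (\<lambda>j. L j n) js) \<in> carrier_mat (sum_list (map d js)) N \<and>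
    dop_mat_act (diag_block_mat (map (\<lambda>j. p j n) js)) V =
      const_mat (stack_rows N (map (\<lambda>j. L j n) js)) * P n"
  using p D L
proof (induction js)
  case Nil
  show ?case
    using carrier_matD[OF P] by (intro bexI[of _ "0\<^sub>m 0 N"])
      (auto simp: stack_rows_Nil dop_mat_act_def const_mat_def mat_eq_iff)
next
  case (Cons j js)
  from Cons.IH Cons.prems obtain V where V: "V \<in> carrier_mat (sum_list (map d js)) N"
    and S: "\<And>n. stack_rows N (map (\<lambda>j. L j n) js) \<in> carrier_mat (sum_list (map d js)) N"
    and act: "\<And>n. dop_mat_act (diag_block_mat (map (\<lambda>j. p j n) js)) V =
      const_mat (stack_rows N (map (\<lambda>j. L j n) js)) * P n"
    by auto
  have j: "p j n \<in> carrier_mat (d j) (d j)" "D j \<in> carrier_mat (d j) N" "L j n \<in> carrier_mat (d j) N"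
    "const_mat (L j n) * P n = dop_mat_act (p j n) (D j)" for n
    using Cons.prems by auto
  have diag: "diag_block_mat (map (\<lambda>j. p j n) js) \<in>
      carrier_mat (sum_list (map d js)) (sum_list (map d js))" for n
    using Cons.prems(1) by (intro diag_block_mat_carrier) auto
  have "dop_mat_act (diag_block_mat (map (\<lambda>j. p j n) (j # js))) (D j @\<^sub>r V) =
      const_mat (stack_rows N (map (\<lambda>j. L j n) (j # js))) * P n" for n
    using dop_mat_act_diag2[OF j(1) diag j(2) V, of n n]
      const_mat_append_rows_mult[OF j(3) S P, of n n n]
    by (simp only: list.map diag_block_mat_Cons stack_rows_Cons[OF j(3)] act j(4))
  moreover have "stack_rows N (map (\<lambda>j. L j n) (j # js)) \<in> carrier_mat (sum_list (map d (j # js))) N" for n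
    using carrier_append_rows[OF j(3) S, of n n] by (simp add: stack_rows_Cons[OF j(3)])
  moreover have "D j @\<^sub>r V \<in> carrier_mat (sum_list (map d (j # js))) N"
    using carrier_append_rows[OF j(2) V] by simp
  ultimately show ?case by blast
qed

text \<open>Converse of \<open>stack_blocks\<close>: \<open>V\<close> and every \<open>A n\<close>
  are cut at the same heights, and since a stack determines its blocks, the relation for the whole
  separates into one relation per block.\<close>

lemma split_blocks:
  assumes P: "\<And>n. P n \<in> carrier_mat N N" and "distinct js"
    and p: "\<And>j n. j \<in> set js \<Longrightarrow> p j n \<in> carrier_mat (d j) (d j)"
    and V: "V \<in> carrier_mat (sum_list (map d js)) N"
    and A: "\<And>n. A n \<in> carrier_mat (sum_list (map d js)) N"
      "\<And>n. dop_mat_act (diag_block_mat (map (\<lambda>j. p j n) js)) V = const_mat (A n) * P n"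
  shows "\<exists>D L. (\<forall>j\<in>set js. D j \<in> carrier_mat (d j) N \<and>
      (\<forall>n. L j n \<in> carrier_mat (d j) N \<and> const_mat (L j n) * P n = dop_mat_act (p j n) (D j))) \<and>
    (\<forall>n. stack_rows N (map (\<lambda>j. L j n) js) = A n)"
  using assms(2-)
proof (induction js arbitrary: V A)
  case Nil
  have "stack_rows N [] = A n" for n
    using Nil.prems(4)[of n] by (auto simp: stack_rows_Nil mat_eq_iff)
  then show ?case by simp
next
  case (Cons j js)
  let ?s = "sum_list (map d js)"
  have "V \<in> carrier_mat (d j + ?s) N" using Cons.prems(3) by simp
  then obtain V1 V2 where V: "V1 \<in> carrier_mat (d j) N" "V2 \<in> carrier_mat ?s N" "V = V1 @\<^sub>r V2"
    by (rule append_rows_split)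
  have "A n \<in> carrier_mat (d j + ?s) N" for n using Cons.prems(4) by simp
  then have "\<exists>A1 A2. A1 \<in> carrier_mat (d j) N \<and> A2 \<in> carrier_mat ?s N \<and> A n = A1 @\<^sub>r A2" for n
    by (metis append_rows_split)
  then obtain A1 A2 where A: "\<And>n. A1 n \<in> carrier_mat (d j) N" "\<And>n. A2 n \<in> carrier_mat ?s N"
    "\<And>n. A n = A1 n @\<^sub>r A2 n"
    by metis
  have pj: "p j n \<in> carrier_mat (d j) (d j)" for n using Cons.prems(2) by simp
  have diag: "diag_block_mat (map (\<lambda>j. p j n) js) \<in> carrier_mat ?s ?s" for n
    using Cons.prems(2) by (intro diag_block_mat_carrier) auto
  have "dop_mat_act (p j n) V1 = const_mat (A1 n) * P n \<and>
    dop_mat_act (diag_block_mat (map (\<lambda>j. p j n) js)) V2 = const_mat (A2 n) * P n" for n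
  proof (subst append_rows_eq_iff[symmetric])
    show "dop_mat_act (p j n) V1 @\<^sub>r dop_mat_act (diag_block_mat (map (\<lambda>j. p j n) js)) V2 =
        (const_mat (A1 n) * P n) @\<^sub>r (const_mat (A2 n) * P n)"
      using Cons.prems(5)[of n]
      by (simp only: list.map diag_block_mat_Cons V(3) A(3) dop_mat_act_diag2[OF pj diag V(1,2)]
          const_mat_append_rows_mult[OF A(1,2) P])
    show "dop_mat_act (p j n) V1 \<in> carrier_mat (d j) N"
      using pj[of n] V(1) by (simp add: dop_mat_act_def)
    show "dop_mat_act (diag_block_mat (map (\<lambda>j. p j n) js)) V2 \<in> carrier_mat ?s N"
      using diag[of n] V(2) by (simp add: dop_mat_act_def)
    show "const_mat (A1 n) * P n \<in> carrier_mat (d j) N" "const_mat (A2 n) * P n \<in> carrier_mat ?s N"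
      using A(1,2) P by (auto intro: mult_carrier_mat const_mat_carrier)
  qed
  then have act: "\<And>n. dop_mat_act (p j n) V1 = const_mat (A1 n) * P n"
    "\<And>n. dop_mat_act (diag_block_mat (map (\<lambda>j. p j n) js)) V2 = const_mat (A2 n) * P n"
    by auto
  have "\<exists>D L. (\<forall>j\<in>set js. D j \<in> carrier_mat (d j) N \<and>
      (\<forall>n. L j n \<in> carrier_mat (d j) N \<and> const_mat (L j n) * P n = dop_mat_act (p j n) (D j))) \<and>
    (\<forall>n. stack_rows N (map (\<lambda>j. L j n) js) = A2 n)"
    using Cons.prems(1,2) V(2) A(2) act(2) by (intro Cons.IH) auto
  then obtain D L where DL: "\<forall>j\<in>set js. D j \<in> carrier_mat (d j) N \<and>
      (\<forall>n. L j n \<in> carrier_mat (d j) N \<and> const_mat (L j n) * P n = dop_mat_act (p j n) (D j))"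
    "\<And>n. stack_rows N (map (\<lambda>j. L j n) js) = A2 n"
    by blast
  \<comment> \<open>As \<open>j\<close> does not occur in \<open>js\<close>, assigning its block
    leaves those of the tail unchanged.\<close>
  have "map (\<lambda>i. (L(j := A1)) i n) js = map (\<lambda>i. L i n) js" for n
    using Cons.prems(1) by auto
  then have "stack_rows N (map (\<lambda>i. (L(j := A1)) i n) (j # js)) =
      stack_rows N (A1 n # map (\<lambda>i. L i n) js)" for n
    by (simp only: list.map fun_upd_same)
  then have "stack_rows N (map (\<lambda>i. (L(j := A1)) i n) (j # js)) = A n" for n
    by (simp only: stack_rows_Cons[OF A(1)] DL(2) A(3))
  moreover have "\<forall>i\<in>set (j # js). (D(j := V1)) i \<in> carrier_mat (d i) N \<and>
      (\<forall>n. (L(j := A1)) i n \<in> carrier_mat (d i) N \<and>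
        const_mat ((L(j := A1)) i n) * P n = dop_mat_act (p i n) ((D(j := V1)) i))"
    using DL(1) V(1) A(1) act(1) by auto
  ultimately show ?case by blast
qed

theorem theorem5p2:
  fixes x0 x1 :: ereal
    and N M :: nat and d :: "nat \<Rightarrow> nat"
    and W :: "real \<Rightarrow> complex mat" and w :: "nat \<Rightarrow> real \<Rightarrow> complex mat"
    and P :: "nat \<Rightarrow> complex poly mat" and p :: "nat \<Rightarrow> nat \<Rightarrow> complex poly mat"
  assumes "x0 < x1"
    and "(\<Sum>j<M. d j) = N"
    and "weight x0 x1 N W" and "mvop x0 x1 N W P"
    and "\<And>j. j < M \<Longrightarrow> weight x0 x1 (d j) (w j)"
    and "\<And>j. j < M \<Longrightarrow> mvop x0 x1 (d j) (w j) (p j)"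
    and "\<And>Vs. Vs \<noteq> [] \<Longrightarrow> set Vs \<subseteq> insert (N, W) ((\<lambda>j. (d j, w j)) ` {..<M}) \<Longrightarrow>
           good_enough x0 x1 (sum_list (map fst Vs)) (weight_direct_sum (map snd Vs))"
  shows "darboux_transformation x0 x1 N (weight_direct_sum (map w [0..<M]))
           (\<lambda>n. diag_block_mat (map (\<lambda>j. p j n) [0..<M])) P \<longleftrightarrow>
         (\<exists>(D :: nat \<Rightarrow> dop mat) (L :: nat \<Rightarrow> nat \<Rightarrow> complex mat).
            (\<forall>j<M. D j \<in> carrier_mat (d j) N \<and>
               (\<forall>n. L j n \<in> carrier_mat (d j) N \<and>
                    const_mat (L j n) * P n = dop_mat_act (p j n) (D j))) \<and>
            (\<exists>n. invertible_mat (stack_rows N (map (\<lambda>j. L j n) [0..<M]))))"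
proof -
  have sum: "sum_list (map d [0..<M]) = N"
    using assms(2) by (simp add: interv_sum_list_conv_sum_set_nat lessThan_atLeast0)
  have W: "weighted_interval x0 x1 N W"
    using assms(1,3) by (rule weighted_interval_if_weight)
  have w: "weighted_interval x0 x1 (d j) (w j)" if "j < M" for j
    using assms(1) assms(5)[OF that] by (rule weighted_interval_if_weight)
  have Z: "weighted_interval x0 x1 N (weight_direct_sum (map w [0..<M]))"
    and Q: "mvop x0 x1 N (weight_direct_sum (map w [0..<M]))
      (\<lambda>n. diag_block_mat (map (\<lambda>j. p j n) [0..<M]))"
    using direct_sum[OF assms(1), of "[0..<M]" d w p] w assms(6) by (auto simp: sum)
  have cP: "P n \<in> carrier_mat N N" for n
    using assms(4) by (simp add: mvop_def)
  have cp: "p j n \<in> carrier_mat (d j) (d j)" if "j \<in> set [0..<M]" for j n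
    using assms(6)[of j] that by (simp add: mvop_def)
  show ?thesis
    \<comment> \<open>With the criterion in place it remains to exchange \<open>V\<close> for its
      row blocks \<open>D j\<close>, the stack of the \<open>L j n\<close> being
      \<open>A n\<close>.\<close>
    unfolding darboux_transformation_iff[OF Z W Q assms(4)]
  proof
    assume "\<exists>V\<in>carrier_mat N N. \<exists>A. (\<forall>n. A n \<in> carrier_mat N N \<and>
        dop_mat_act (diag_block_mat (map (\<lambda>j. p j n) [0..<M])) V = const_mat (A n) * P n) \<and>
      (\<exists>n. invertible_mat (A n))"
    then obtain V A where V: "V \<in> carrier_mat N N" and A: "\<And>n. A n \<in> carrier_mat N N"
      "\<And>n. dop_mat_act (diag_block_mat (map (\<lambda>j. p j n) [0..<M])) V = const_mat (A n) * P n"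
      and inv: "\<exists>n. invertible_mat (A n)"
      by blast
    have "\<exists>D L. (\<forall>j\<in>set [0..<M]. D j \<in> carrier_mat (d j) N \<and>
        (\<forall>n. L j n \<in> carrier_mat (d j) N \<and> const_mat (L j n) * P n = dop_mat_act (p j n) (D j))) \<and>
      (\<forall>n. stack_rows N (map (\<lambda>j. L j n) [0..<M]) = A n)"
      by (rule split_blocks[where V = V, OF cP distinct_upt cp]) (simp_all add: sum V A)
    then obtain D L where "\<forall>j\<in>set [0..<M]. D j \<in> carrier_mat (d j) N \<and>
        (\<forall>n. L j n \<in> carrier_mat (d j) N \<and> const_mat (L j n) * P n = dop_mat_act (p j n) (D j))"
      "\<forall>n. stack_rows N (map (\<lambda>j. L j n) [0..<M]) = A n"
      by blast
    then show "\<exists>D L. (\<forall>j<M. D j \<in> carrier_mat (d j) N \<and>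
        (\<forall>n. L j n \<in> carrier_mat (d j) N \<and> const_mat (L j n) * P n = dop_mat_act (p j n) (D j))) \<and>
      (\<exists>n. invertible_mat (stack_rows N (map (\<lambda>j. L j n) [0..<M])))"
      using inv by (intro exI[of _ D] exI[of _ L]) auto
  next
    assume "\<exists>D L. (\<forall>j<M. D j \<in> carrier_mat (d j) N \<and>
        (\<forall>n. L j n \<in> carrier_mat (d j) N \<and> const_mat (L j n) * P n = dop_mat_act (p j n) (D j))) \<and>
      (\<exists>n. invertible_mat (stack_rows N (map (\<lambda>j. L j n) [0..<M])))"
    then obtain D L where D: "\<And>j. j < M \<Longrightarrow> D j \<in> carrier_mat (d j) N"
      and L: "\<And>j n. j < M \<Longrightarrow> L j n \<in> carrier_mat (d j) N"
        "\<And>j n. j < M \<Longrightarrow> const_mat (L j n) * P n = dop_mat_act (p j n) (D j)"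
      and inv: "\<exists>n. invertible_mat (stack_rows N (map (\<lambda>j. L j n) [0..<M]))"
      by blast
    have "\<exists>V\<in>carrier_mat N N. \<forall>n. stack_rows N (map (\<lambda>j. L j n) [0..<M]) \<in> carrier_mat N N \<and>
        dop_mat_act (diag_block_mat (map (\<lambda>j. p j n) [0..<M])) V =
          const_mat (stack_rows N (map (\<lambda>j. L j n) [0..<M])) * P n"
      using stack_blocks[where js = "[0..<M]" and p = p and d = d and D = D and L = L, OF cP cp] D L
      by (simp add: sum)
    then obtain V where V: "V \<in> carrier_mat N N"
      "\<forall>n. stack_rows N (map (\<lambda>j. L j n) [0..<M]) \<in> carrier_mat N N \<and>
        dop_mat_act (diag_block_mat (map (\<lambda>j. p j n) [0..<M])) V =
          const_mat (stack_rows N (map (\<lambda>j. L j n) [0..<M])) * P n"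
      by (rule bexE)
    show "\<exists>V\<in>carrier_mat N N. \<exists>A. (\<forall>n. A n \<in> carrier_mat N N \<and>
        dop_mat_act (diag_block_mat (map (\<lambda>j. p j n) [0..<M])) V = const_mat (A n) * P n) \<and>
      (\<exists>n. invertible_mat (A n))"
      by (rule bexI[OF _ V(1)], rule exI, rule conjI[OF V(2) inv])
  qed
qed

end
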